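(* Let $H\in\mathbb{C}^{N\times N}$ be Hermitian negative definite with eigenvalues $\lambda_1\le\dots\le\lambda_N<0$, and let $\alpha\in(0,1)$. For all $\mu>0$, $$\min E_\mu-\min E_0\le\mu\min_{X_0\in S_0}\|X_0\|_{1}.$$ Moreover, if $\lambda_m<\lambda_{m+1}$, then there is $\mu_0>0$ such that for all $0<\mu<\mu_0$ and all $X_\mu\in S_\mu$, $$E_0(X_\mu)-\min E_0\le\frac{\mu^2}{\alpha(\lambda_{m+1}-\lambda_m)}\cdot\min\Bigl\{\operatorname{nnz}(X_0-X_\mu): X_0\in\operatorname*{arg\,min}_{G\in S_0}\|X_\mu-G\|_F\Bigr\}\le\frac{\mu^2Nm}{\alpha(\lambda_{m+1}-\lambda_m)}.$$
   Context: $N,m$ are positive integers (with $m<N$ in the second part, so that $\lambda_{m+1}$ makes sense), and eigenvalues are listed with multiplicity. For $X\in\mathbb{C}^{N\times m}$, $\|X\|_1=\sum_{i,j}|X_{ij}|$ is the entrywise $\ell^1$ norm, $\|X\|_F$ is the Frobenius norm, $\operatorname{nnz}(X)$ is the number of nonzero entries of $X$, and $X^*$ is the conjugate transpose. $E_0(X)=\operatorname{tr}\bigl[(2I-X^*X)X^*HX\bigr]$ and, for $\mu\ge0$, $E_\mu(X)=E_0(X)+\mu\|X\|_1$; minima are over all of $\mathbb{C}^{N\times m}$. The set $S_\mu$ is the set of all global minimizers of $E_\mu$ over $\mathbb{C}^{N\times m}$ (with $S_0$ the set of global minimizers of $E_0$). The threshold $\mu_0$ may depend on $H$, $N$, $m$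 and $\alpha$. *)

theory Defs
  imports "HOL-Analysis.Analysis"
begin

text \<open>Matrices in $C^{N \times m}$ are elements of \<^typ>\<open>complex^'m^'n\<close> with $N$ = \<open>CARD('n)\<close> and
  $m$ = \<open>CARD('m)\<close>.\<close>

definition ctranspose :: "complex^'m^'n \<Rightarrow> complex^'n^'m" where
  "ctranspose X = (\<chi> j i. cnj (X $ i $ j))"

definition hermitian :: "complex^'n^'n \<Rightarrow> bool" where
  "hermitian H \<longleftrightarrow> ctranspose H = H"

text \<open>The Hermitian form is real when \<open>H\<close> is Hermitian, so \<open>Re\<close> loses nothing there.\<close>

definition negative_definite :: "complex^'n^'n \<Rightarrow> bool" where
  "negative_definite H \<longleftrightarrow>
     (\<forall>x. x \<noteq> 0 \<longrightarrow> Re (\<Sum>i\<in>UNIV. cnj (x $ i) * (H *v x) $ i) < 0)"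

text \<open>\<open>ev 1 \<le> \<dots> \<le> ev N\<close> are the roots of the characteristic polynomial of \<open>H\<close>, listed
  with multiplicity; values of \<open>ev\<close> outside \<open>{1..N}\<close> are irrelevant.\<close>

definition ordered_eigenvalues :: "complex^'n^'n \<Rightarrow> (nat \<Rightarrow> real) \<Rightarrow> bool" where
  "ordered_eigenvalues H ev \<longleftrightarrow>
     mono_on {1..CARD('n)} ev \<and>
     (\<forall>z. det (mat z - H) = (\<Prod>i = 1..CARD('n). (z - complex_of_real (ev i))))"

definition l1_norm :: "complex^'m^'n \<Rightarrow> real" where
  "l1_norm X = (\<Sum>i\<in>UNIV. \<Sum>j\<in>UNIV. cmod (X $ i $ j))"

definition nnz :: "complex^'m^'n \<Rightarrow> nat" where
  "nnz X = card {(i, j). X $ i $ j \<noteq> 0}"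

text \<open>The Frobenius norm is the library norm on \<^typ>\<open>complex^'m^'n\<close>.\<close>

lemma norm_eq_frobenius:
  fixes X :: "complex^'m^'n"
  shows "norm X = sqrt (\<Sum>i\<in>UNIV. \<Sum>j\<in>UNIV. (cmod (X $ i $ j))\<^sup>2)"
  by (simp add: norm_vec_def L2_set_def sum_nonneg)

definition E0_trace :: "complex^'n^'n \<Rightarrow> complex^'m^'n \<Rightarrow> complex" where
  "E0_trace H X =
     trace ((mat 2 - ctranspose X ** X) ** (ctranspose X ** H ** X))"

definition E0 :: "complex^'n^'n \<Rightarrow> complex^'m^'n \<Rightarrow> real" where
  "E0 H X = Re (E0_trace H X)"

definition E :: "complex^'n^'n \<Rightarrow> real \<Rightarrow> complex^'m^'n \<Rightarrow> real" where
  "E H \<mu> X = E0 H X + \<mu> * l1_norm X"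

lemma ctranspose_mult: "ctranspose (A ** B) = ctranspose B ** ctranspose A"
  by (simp add: ctranspose_def matrix_matrix_mult_def vec_eq_iff mult.commute)

lemma ctranspose_ctranspose [simp]: "ctranspose (ctranspose A) = A"
  by (simp add: ctranspose_def vec_eq_iff)

lemma trace_ctranspose: "trace (ctranspose A) = cnj (trace A)"
  by (simp add: ctranspose_def trace_def)

text \<open>For Hermitian \<open>H\<close> the trace is real, so taking \<open>Re\<close> in \<^const>\<open>E0\<close> loses nothing.\<close>

lemma of_real_E0:
  fixes X :: "complex^'m^'n"
  assumes "hermitian H"
  shows "complex_of_real (E0 H X) = E0_trace H X"
proof -
  let ?A = "mat 2 - ctranspose X ** X" and ?B = "ctranspose X ** H ** X"
  have "ctranspose (mat 2 - Y) = mat 2 - ctranspose Y" for Y :: "complex^'m^'m"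
    by (auto simp: ctranspose_def mat_def vec_eq_iff)
  then have A: "ctranspose ?A = ?A"
    by (simp add: ctranspose_mult)
  have B: "ctranspose ?B = ?B"
    using assms by (simp add: ctranspose_mult hermitian_def matrix_mul_assoc)
  have "cnj (trace (?A ** ?B)) = trace (?B ** ?A)"
    by (metis A B ctranspose_mult trace_ctranspose)
  then have "cnj (E0_trace H X) = E0_trace H X"
    unfolding E0_trace_def by (metis trace_mul_sym)
  then show ?thesis
    by (simp add: E0_def complex_eq_iff)
qed

definition minimizers :: "('a \<Rightarrow> 'b::linorder) \<Rightarrow> 'a set \<Rightarrow> 'a set" where
  "minimizers f A = {x. is_arg_min f (\<lambda>y. y \<in> A) x}"

text \<open>This is the minimum only when it is attained, i.e. when \<^term>\<open>minimizers f A \<noteq> {}\<close>.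
  Attainment is therefore always stated alongside it.\<close>

definition min_value :: "('a \<Rightarrow> 'b::conditionally_complete_linorder) \<Rightarrow> 'a set \<Rightarrow> 'b" where
  "min_value f A = (INF x\<in>A. f x)"

lemma min_value_eq: "x \<in> minimizers f A \<Longrightarrow> min_value f A = f x"
  unfolding min_value_def minimizers_def
  by (auto simp: is_arg_min_linorder intro!: cInf_eq_minimum)

definition S :: "complex^'n^'n \<Rightarrow> real \<Rightarrow> (complex^'m^'n) set" where
  "S H \<mu> = minimizers (E H \<mu>) UNIV"

lemma E_0 [simp]: "E H 0 = E0 H"
  by (simp add: E_def fun_eq_iff)

end

theory Submission imports Defs begin

text \<open>
  Diagonalise \<open>H\<close> and pass to eigencoordinates; with \<open>a\<^sub>i > 0\<close> the negated eigenvalues, the energy becomes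
  \<open>\<Sum> a\<^sub>i (|row\<^sub>i (1 - Y Y*)|\<^sup>2 - 1)\<close>. Varying a minimizer \<open>Y\<close> in the direction \<open>(1 - Y Y*) Y\<close> forces
  \<open>Y Y*\<close> to be a projection, and comparing diagonal entries shows that under the gap condition it is the
  projection onto the \<open>m\<close> lowest eigenvectors. If \<open>X\<^sub>0\<close> is a minimizer nearest to \<open>X\<close>, then \<open>X\<^sub>0* X\<close> is
  Hermitian, and expanding the energy around \<open>X\<^sub>0\<close> gives
  \<open>E\<^sub>0 X - min E\<^sub>0 \<ge> (\<lambda>\<^sub>m\<^sub>+\<^sub>1 - \<lambda>\<^sub>m - O(d)) d\<^sup>2\<close> with \<open>d = |X - X\<^sub>0|\<close>. Minimality of \<open>X = X\<^sub>\<mu>\<close> bounds the same excess by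
  \<open>\<mu> (|X\<^sub>0|\<^sub>1 - |X|\<^sub>1) \<le> \<mu> sqrt (nnz (X\<^sub>0 - X)) d\<close>; eliminating \<open>d\<close> gives the claim. Compactness puts
  \<open>X\<^sub>\<mu>\<close> in the region where the growth estimate applies once \<open>\<mu>\<close> is small.
\<close>

subsection \<open>Matrix preliminaries and diagonalisation of Hermitian matrices\<close>

lemma inner_complex_vec: "inner x (y :: complex^'n) = Re (\<Sum>i\<in>UNIV. cnj (x $ i) * y $ i)"
  by (simp add: inner_vec_def inner_complex_def)

lemma inner_adjoint:
  fixes A :: "complex^'n^'m"
  shows "inner x (A *v y) = inner (ctranspose A *v x) y"
  unfolding inner_complex_vec ctranspose_def matrix_vector_mult_def
  by (simp add: sum_distrib_left sum_distrib_right sum.swap[of _ "UNIV :: 'n set"] algebra_simps del: Re_sum)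

lemma norm_eq_frobenius_rows: "(norm (X :: complex^'m^'n))\<^sup>2 = (\<Sum>i\<in>UNIV. (norm (X $ i))\<^sup>2)"
  by (simp add: norm_vec_def L2_set_def sum_nonneg)

lemma norm_row_square: "(norm ((A :: complex^'m^'n) $ i))\<^sup>2 = (\<Sum>j\<in>UNIV. (cmod (A $ i $ j))\<^sup>2)"
  by (simp add: norm_vec_def L2_set_def sum_nonneg)

lemma inner_rows: "inner ((A :: complex^'m^'n) $ i) (B $ i) = Re ((B ** ctranspose A) $ i $ i)"
  by (simp add: inner_complex_vec matrix_matrix_mult_def ctranspose_def mult.commute)

lemma norm_row_square_gram: "(norm ((A :: complex^'m^'n) $ i))\<^sup>2 = Re ((A ** ctranspose A) $ i $ i)"
  by (simp add: power2_norm_eq_inner inner_rows)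

lemma norm_ctranspose: "norm (ctranspose (X :: complex^'m^'n)) = norm X"
  unfolding norm_eq_frobenius
  by (subst sum.swap) (simp add: ctranspose_def)

lemma ctranspose_add: "ctranspose (A + B) = ctranspose A + ctranspose B"
  by (simp add: ctranspose_def vec_eq_iff)

lemma ctranspose_diff: "ctranspose (A - B) = ctranspose A - ctranspose B"
  by (simp add: ctranspose_def vec_eq_iff)

lemma ctranspose_mat_1 [simp]: "ctranspose (mat 1) = mat 1"
  by (auto simp: ctranspose_def mat_def vec_eq_iff)

lemma matrix_diff_ldistrib: "(A :: complex^'n^'m) ** (B - C) = A ** B - A ** C"
  by (simp add: vec_eq_iff matrix_matrix_mult_def right_diff_distrib sum_subtractf)

lemma matrix_diff_rdistrib: "(B - C) ** (A :: complex^'n^'m) = B ** A - C ** A"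
  by (simp add: vec_eq_iff matrix_matrix_mult_def left_diff_distrib sum_subtractf)

section \<open>Spectral theorem for Hermitian matrices, with eigenvalues matched to a given
  list\<close>

lemma of_real_smult: "complex_of_real c *s x = c *\<^sub>R x"
  unfolding vec_eq_iff vector_smult_component vector_scaleR_component
  by (simp add: scaleR_conv_of_real)

text \<open>Induction on \<open>B\<close>: in the orthogonal complement of the eigenvectors already
  found, a unit vector minimizing the Rayleigh quotient is the next eigenvector.\<close>

lemma hermitian_orthonormal_eigenvectors:
  fixes H :: "complex^'n^'n" and B :: "'n set"
  assumes H: "hermitian H"
  shows "\<exists>v d. (\<forall>i\<in>B. H *v v i = complex_of_real (d i) *s v i \<and>
     (\<forall>j\<in>B. (\<Sum>k\<in>UNIV. cnj (v i $ k) * v j $ k) = (if i = j then 1 else 0)))"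
proof (induction rule: finite_induct[OF finite[of B]])
  case 1
  then show ?case by simp
next
  case (2 b B)
  then obtain v and d :: "'n \<Rightarrow> real" where ev: "\<And>i. i \<in> B \<Longrightarrow> H *v v i = complex_of_real (d i) *s v i"
    and on: "\<And>i j. \<lbrakk>i \<in> B; j \<in> B\<rbrakk> \<Longrightarrow> (\<Sum>k\<in>UNIV. cnj (v i $ k) * v j $ k) = (if i = j then 1 else 0)"
    by blast
  \<comment> \<open>The inner product is the real one; including the multiples by the imaginary unit
    makes real orthogonality to \<open>W\<close> the same as complex orthogonality to every
    \<open>v i\<close>. At most \<open>2 * card B\<close> vectors cannot span a real space of
    dimension \<open>2 * CARD('n)\<close>.\<close>
  define W where "W = v ` B \<union> (\<lambda>i. \<i> *s v i) ` B"
  define T where "T = {x. \<forall>w\<in>W. inner w x = 0}"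
  have "dim W \<le> card W" by (rule dim_le_card') (simp add: W_def)
  also have "\<dots> \<le> card B + card B" unfolding W_def
    by (meson add_mono card_Un_le card_image_le finite le_trans)
  also have "\<dots> < DIM(complex^'n)"
  proof -
    have "card B < CARD('n)" using \<open>b \<notin> B\<close> by (metis finite psubset_card_mono psubsetI subset_UNIV UNIV_I)
    then show ?thesis by simp
  qed
  finally have "dim W < DIM(complex^'n)" .
  then obtain x0 where x0: "x0 \<noteq> 0" "\<And>w. w \<in> span W \<Longrightarrow> orthogonal x0 w"
    using orthogonal_to_subspace_exists by blast
  have x0T: "x0 \<in> T"
    using x0(2) by (auto simp: T_def orthogonal_def span_base inner_commute)
  have T_sub: "x + t *\<^sub>R y \<in> T" "t *\<^sub>R x \<in> T" if "x \<in> T" "y \<in> T" for x y t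
    using that by (auto simp: T_def inner_add_right)
  have T_orth: "(\<Sum>k\<in>UNIV. cnj (v i $ k) * x $ k) = 0" if "x \<in> T" "i \<in> B" for x i
  proof -
    have "inner (v i) x = 0" "inner (\<i> *s v i) x = 0"
      using that by (auto simp: T_def W_def)
    moreover have "inner (\<i> *s v i) x = Re (\<Sum>k\<in>UNIV. - \<i> * (cnj (v i $ k) * x $ k))"
      by (simp only: inner_complex_vec vector_smult_component complex_cnj_mult complex_cnj_i mult.assoc)
    then have "inner (\<i> *s v i) x = Im (\<Sum>k\<in>UNIV. cnj (v i $ k) * x $ k)"
      by (simp only: sum_distrib_left[symmetric]) simp
    ultimately show ?thesis by (simp only: inner_complex_vec complex_eq_iff zero_complex.sel)
  qed
  have sa: "inner x (H *v y) = inner (H *v x) y" for x y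
    using inner_adjoint[of x H y] H by (simp add: hermitian_def)
  have scale: "H *v (c *\<^sub>R y) = c *\<^sub>R (H *v y)" for c y
    by (rule linear_scale[OF matrix_vector_mul_linear])
  have closedT: "closed T"
  proof -
    have "T = (\<Inter>w\<in>W. {x. inner w x = 0})" by (auto simp: T_def)
    moreover have "closed {x. inner w x = 0}" for w :: "complex^'n"
      by (rule closed_hyperplane)
    ultimately show ?thesis by auto
  qed
  let ?K = "T \<inter> sphere 0 1"
  have "compact ?K" using closedT by (simp add: closed_Int_compact)
  moreover have "x0 /\<^sub>R norm x0 \<in> ?K" using x0 x0T T_sub by simp
  moreover have "continuous_on ?K (\<lambda>x. inner x (H *v x))"
    by (intro continuous_intros)
  ultimately have "\<exists>x\<in>?K. \<forall>y\<in>?K. inner x (H *v x) \<le> inner y (H *v y)"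
    by (intro continuous_attains_inf) auto
  then obtain x where x: "x \<in> ?K" and xmin: "\<And>y. y \<in> ?K \<Longrightarrow> inner x (H *v x) \<le> inner y (H *v y)"
    by blast
  define l where "l = inner x (H *v x)"
  have Rayleigh: "l * (norm y)\<^sup>2 \<le> inner y (H *v y)" if "y \<in> T" for y
  proof (cases "y = 0")
    case False
    then have "y /\<^sub>R norm y \<in> ?K" using that T_sub by simp
    from xmin[OF this] have le: "l \<le> inner (y /\<^sub>R norm y) (H *v (y /\<^sub>R norm y))" by (simp only: l_def)
    have "inner (y /\<^sub>R norm y) (H *v (y /\<^sub>R norm y)) = inner y (H *v y) / (norm y)\<^sup>2"
      by (simp only: scale inner_scaleR_left inner_scaleR_right) (simp add: power2_eq_square divide_inverse)
    with le have "l \<le> inner y (H *v y) / (norm y)\<^sup>2"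
      by simp
    then show ?thesis using False by (simp add: field_simps)
  qed simp
  \<comment> \<open>The residual \<open>z\<close> stays in \<open>T\<close> because \<open>W\<close>
    consists of eigenvectors and \<open>H\<close> is self-adjoint, so
    \<open>x + t *\<^sub>R z\<close> is an admissible variation of the minimizer
    \<open>x\<close>.\<close>
  define z where "z = H *v x - l *\<^sub>R x"
  have zT: "z \<in> T"
  proof -
    have "inner w z = 0" if "w \<in> W" for w
    proof -
      have "\<exists>c. \<exists>i\<in>B. w = c *s v i" using that unfolding W_def
        by (auto) (metis vector_smult_lid)
      then obtain c i where w: "w = c *s v i" "i \<in> B" by blast
      have "H *v w = complex_of_real (d i) *s w"
      proof -
        have "H *v (c *s v i) = c *s (H *v v i)"
          by (simp add: vec.scale)
        then show ?thesis using w ev by (simp add: mult.commute)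
      qed
      moreover have "complex_of_real (d i) *s w = d i *\<^sub>R w"
        by (rule of_real_smult)
      ultimately have "inner w (H *v x) = d i * inner w x" using sa[of w x] by simp
      moreover have "inner w x = 0" using x that by (simp add: T_def)
      ultimately show ?thesis by (simp add: z_def inner_diff_right)
    qed
    then show ?thesis by (simp add: T_def)
  qed
  have "inner z z = 0"
  proof -
    define c where "c = inner z (H *v z) - l * inner z z"
    have nx: "inner x x = 1" using x by (simp add: dot_square_norm)
    \<comment> \<open>The Rayleigh inequality at \<open>x + t *\<^sub>R z\<close>; after
      cancellation its linear coefficient is twice \<open>inner z z\<close>, which must therefore
      vanish.\<close>
    have key: "0 \<le> 2 * t * inner z z + t\<^sup>2 * c" for t
    proof -
      have "l * (norm (x + t *\<^sub>R z))\<^sup>2 \<le> inner (x + t *\<^sub>R z) (H *v (x + t *\<^sub>R z))"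
        using x zT T_sub by (intro Rayleigh) auto
      also have "\<dots> = l + t * inner x (H *v z) + t * inner z (H *v x) + t * t * inner z (H *v z)"
        by (simp add: l_def scale matrix_vector_right_distrib inner_add_left inner_add_right algebra_simps)
      also have "inner x (H *v z) = inner z (H *v x)" using sa[of x z] by (simp add: inner_commute)
      also have "inner z (H *v x) = inner z z + l * inner z x"
        by (simp add: z_def inner_diff_right)
      also have "(norm (x + t *\<^sub>R z))\<^sup>2 = inner x x + 2 * t * inner z x + t * t * inner z z"
        by (simp add: power2_norm_eq_inner inner_add_left inner_add_right inner_commute[of x z] algebra_simps)
      finally show ?thesis
        by (simp add: nx c_def power2_eq_square algebra_simps)
    qed
    show ?thesis
    proof (rule ccontr)
      assume "inner z z \<noteq> 0"
      then have p: "inner z z > 0" by (simp add: order_less_le)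
      \<comment> \<open>A negative step so short that the quadratic term cannot absorb the linear
        one; the \<open>+ 1\<close> covers \<open>c = 0\<close>.\<close>
      define t where "t = - inner z z / (\<bar>c\<bar> + 1)"
      have c1: "\<bar>c\<bar> + 1 > 0" by linarith
      have "t < 0" unfolding t_def using p c1 by (intro divide_neg_pos) linarith+
      have "0 \<le> t * (2 * inner z z + t * c)"
        using key[of t] by (simp add: power2_eq_square algebra_simps)
      then have "2 * inner z z + t * c \<le> 0"
        using \<open>t < 0\<close> by (simp add: zero_le_mult_iff)
      moreover have "- t * c \<le> inner z z"
      proof -
        have "- t * c \<le> - t * (\<bar>c\<bar> + 1)" using \<open>t < 0\<close> by (intro mult_left_mono) auto
        also have "\<dots> = inner z z" using c1 by (simp add: t_def)
        finally show ?thesis .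
      qed
      ultimately show False using p by linarith
    qed
  qed
  then have Hx: "H *v x = complex_of_real l *s x"
    by (simp add: z_def of_real_smult)
  have xx: "(\<Sum>k\<in>UNIV. cnj (x $ k) * x $ k) = 1"
  proof -
    have "(\<Sum>k\<in>UNIV. cnj (x $ k) * x $ k) = of_real ((norm x)\<^sup>2)"
      by (simp add: norm_vec_def L2_set_def sum_nonneg complex_norm_square mult.commute del: of_real_power)
    then show ?thesis using x by simp
  qed
  have xo: "(\<Sum>k\<in>UNIV. cnj (x $ k) * v i $ k) = 0" if "i \<in> B" for i
  proof -
    have "(\<Sum>k\<in>UNIV. cnj (x $ k) * v i $ k) = cnj (\<Sum>k\<in>UNIV. cnj (v i $ k) * x $ k)"
      by (simp add: mult.commute)
    also have "\<dots> = 0" using T_orth[of x i] x that by simp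
    finally show ?thesis .
  qed
  have "\<forall>i\<in>insert b B. H *v (v(b := x)) i = complex_of_real ((d(b := l)) i) *s (v(b := x)) i \<and>
     (\<forall>j\<in>insert b B. (\<Sum>k\<in>UNIV. cnj ((v(b := x)) i $ k) * (v(b := x)) j $ k) = (if i = j then 1 else 0))"
    using \<open>b \<notin> B\<close> Hx xx xo T_orth x ev on by auto
  then show ?case by blast
qed

definition diag_mat :: "('n \<Rightarrow> real) \<Rightarrow> complex^'n^'n" where
  "diag_mat d = (\<chi> i j. if i = j then complex_of_real (d i) else 0)"

lemma hermitian_diagonalization:
  fixes H :: "complex^'n^'n"
  assumes "hermitian H"
  obtains U :: "complex^'n^'n" and d where "ctranspose U ** U = mat 1" "U ** ctranspose U = mat 1" "H = U ** diag_mat d ** ctranspose U"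
proof -
  obtain v and d :: "'n \<Rightarrow> real" where vd: "\<forall>i\<in>UNIV. H *v v i = complex_of_real (d i) *s v i \<and>
     (\<forall>j\<in>UNIV. (\<Sum>k\<in>UNIV. cnj (v i $ k) * v j $ k) = (if i = j then 1 else 0))"
    using hermitian_orthonormal_eigenvectors[OF assms, of UNIV] by blast
  then have ev: "\<And>i. H *v v i = complex_of_real (d i) *s v i"
    and on: "\<And>i j. (\<Sum>k\<in>UNIV. cnj (v i $ k) * v j $ k) = (if i = j then 1 else 0)"
    by (blast, simp)
  define U :: "complex^'n^'n" where "U = (\<chi> i j. v j $ i)"
  have U1: "ctranspose U ** U = mat 1"
    using on by (simp add: vec_eq_iff matrix_matrix_mult_def ctranspose_def U_def mat_def)
  then have U2: "U ** ctranspose U = mat 1"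
    using matrix_left_right_inverse by blast
  have "H ** U = U ** diag_mat d"
  proof -
    have "(H ** U) $ i $ j = (U ** diag_mat d) $ i $ j" for i j
      using arg_cong[OF ev[of j], of "\<lambda>x. x $ i"]
      by (simp add: matrix_matrix_mult_def matrix_vector_mult_def U_def diag_mat_def mult_delta_right mult.commute)
    then show ?thesis by (simp add: vec_eq_iff)
  qed
  then have "H ** U ** ctranspose U = U ** diag_mat d ** ctranspose U" by simp
  then have "H = U ** diag_mat d ** ctranspose U"
    by (simp add: U2 flip: matrix_mul_assoc)
  then show thesis using that U1 U2 by blast
qed

text \<open>\<open>f a\<close> is a root of the left product, hence equals some \<open>g b\<close>;
  cancel the common factor and induct. Multiplicities are respected without being counted.\<close>

lemma bij_from_equal_linear_products:
  fixes f :: "'a \<Rightarrow> complex" and g :: "'b \<Rightarrow> complex"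
  assumes "finite A" "finite B"
    and "(\<Prod>i\<in>A. [:- f i, 1:]) = (\<Prod>i\<in>B. [:- g i, 1:])"
  shows "\<exists>s. bij_betw s A B \<and> (\<forall>i\<in>A. f i = g (s i))"
  using assms
proof (induction A arbitrary: B)
  case empty
  have "B = {}"
  proof (rule ccontr)
    assume "B \<noteq> {}"
    then obtain b where "b \<in> B" by blast
    then have "poly (\<Prod>i\<in>B. [:- g i, 1:]) (g b) = 0"
      using empty.prems(1) by (auto simp: poly_prod)
    then show False using empty.prems(2)[symmetric] by simp
  qed
  then show ?case by (simp add: bij_betw_def)
next
  case (insert a A)
  have "poly (\<Prod>i\<in>B. [:- g i, 1:]) (f a) = 0"
    using insert.hyps insert.prems(2)[symmetric] by simp
  then obtain b where b: "b \<in> B" "g b = f a"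
    using insert.prems(1) by (auto simp: poly_prod)
  have "[:- f a, 1:] * (\<Prod>i\<in>A. [:- f i, 1:]) = [:- f a, 1:] * (\<Prod>i\<in>B - {b}. [:- g i, 1:])"
    using insert.hyps insert.prems b by (simp add: prod.remove[of B b])
  then have "(\<Prod>i\<in>A. [:- f i, 1:]) = (\<Prod>i\<in>B - {b}. [:- g i, 1:])"
    by (subst (asm) mult_left_cancel) auto
  from insert.IH[OF _ this] obtain s where s: "bij_betw s A (B - {b})" "\<forall>i\<in>A. f i = g (s i)"
    using insert.prems(1) by auto
  have "bij_betw (s(a := b)) (insert a A) B"
    using s(1) b insert.hyps(2) unfolding bij_betw_def inj_on_def
    by (auto simp: image_iff)
  moreover have "\<forall>i\<in>insert a A. f i = g ((s(a := b)) i)" using s(2) b insert.hyps(2) by auto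
  ultimately show ?case by blast
qed

lemma det_diag_mat_pencil:
  "det (mat z - diag_mat d :: complex^'n^'n) = (\<Prod>i\<in>UNIV. z - complex_of_real (d i))"
  by (subst det_diagonal) (auto simp: diag_mat_def mat_def)

text \<open>Unitary conjugation preserves the characteristic polynomial, so the diagonal found and
  the list \<open>ev\<close> have the same roots with multiplicity; \<open>s\<close> records the
  position of each coordinate in the ordered list.\<close>

lemma hermitian_ordered_diagonalization:
  fixes H :: "complex^'n^'n"
  assumes "hermitian H" and "ordered_eigenvalues H ev"
  obtains U :: "complex^'n^'n" and s where "ctranspose U ** U = mat 1" "U ** ctranspose U = mat 1"
    "H = U ** diag_mat (\<lambda>i. ev (s i)) ** ctranspose U" "bij_betw s (UNIV :: 'n set) {1..CARD('n)}"
proof -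
  obtain U :: "complex^'n^'n" and d where U: "ctranspose U ** U = mat 1" "U ** ctranspose U = mat 1"
    and H: "H = U ** diag_mat d ** ctranspose U"
    using hermitian_diagonalization assms(1) by blast
  have "(\<Prod>i\<in>UNIV. z - complex_of_real (d i)) = (\<Prod>k=1..CARD('n). z - complex_of_real (ev k))" for z
  proof -
    have "mat z = U ** (mat z) ** ctranspose U"
    proof -
      have "U ** mat z = mat z ** U"
        by (simp add: vec_eq_iff matrix_matrix_mult_def mat_def mult_delta_left mult_delta_right)
      then show ?thesis by (simp add: U(2) flip: matrix_mul_assoc)
    qed
    then have "mat z - H = U ** (mat z - diag_mat d) ** ctranspose U"
      by (simp add: H matrix_diff_ldistrib matrix_diff_rdistrib)
    then have "det (mat z - H) = det U * det (mat z - diag_mat d) * det (ctranspose U)"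
      by (simp only: det_mul)
    moreover have "det U * det (ctranspose U) = 1"
      by (simp add: U(2) flip: det_mul)
    ultimately have "det (mat z - H) = det (mat z - diag_mat d)" by (metis mult.assoc mult.commute mult_1)
    then show ?thesis using assms(2) by (simp add: ordered_eigenvalues_def det_diag_mat_pencil)
  qed
  \<comment> \<open>Complex polynomials are determined by their values, which turns the pointwise
    identity into one between products of linear factors.\<close>
  then have "(\<Prod>i\<in>UNIV. [:- complex_of_real (d i), 1:]) = (\<Prod>k=1..CARD('n). [:- complex_of_real (ev k), 1:])"
    by (intro poly_eq_poly_eq_iff[THEN iffD1] ext) (simp add: poly_prod)
  from bij_from_equal_linear_products[OF _ _ this] obtain s
    where s: "bij_betw s (UNIV :: 'n set) {1..CARD('n)}" "\<And>i. d i = ev (s i)" by auto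
  have "d = (\<lambda>i. ev (s i))" using s by auto
  then show thesis using that U H s(1) by blast
qed

subsection \<open>The energy in eigencoordinates\<close>

lemma matrix_add_rdistrib: "(B + C) ** (A :: complex^'n^'m) = B ** A + C ** A"
  by (simp add: vec_eq_iff matrix_matrix_mult_def distrib_right sum.distrib)

lemma ctranspose_scaleR: "ctranspose (t *\<^sub>R A) = t *\<^sub>R ctranspose A"
  by (simp add: ctranspose_def vec_eq_iff)

definition diag_energy :: "('n \<Rightarrow> real) \<Rightarrow> complex^'m^'n \<Rightarrow> real" where
  "diag_energy a Y = (\<Sum>i\<in>UNIV. a i * ((norm ((mat 1 - Y ** ctranspose Y) $ i))\<^sup>2 - 1))"

lemma gram_diag: "((Y :: complex^'m^'n) ** ctranspose Y) $ i $ i = complex_of_real ((norm (Y $ i))\<^sup>2)"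
  by (simp add: norm_row_square matrix_matrix_mult_def ctranspose_def complex_norm_square del: of_real_power)

lemma inner_eq_sum_diag:
  "inner (X :: complex^'m^'n) Y = (\<Sum>i\<in>UNIV. Re ((Y ** ctranspose X) $ i $ i))"
  by (simp add: inner_vec_def[of X Y] inner_rows)

lemma inner_eq_trace: "inner (X :: complex^'m^'n) Y = Re (trace (ctranspose X ** Y))"
proof -
  have "trace (ctranspose X ** Y) = trace (Y ** ctranspose X)" by (rule trace_mul_sym)
  then show ?thesis by (simp add: inner_eq_sum_diag trace_def)
qed

lemma norm_unitary_mult:
  fixes U :: "complex^'n^'n" and X :: "complex^'m^'n"
  assumes "ctranspose U ** U = mat 1"
  shows "norm (U ** X) = norm X"
proof -
  have "ctranspose (U ** X) ** (U ** X) = ctranspose X ** (ctranspose U ** U) ** X"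
    by (simp add: ctranspose_mult matrix_mul_assoc)
  then show ?thesis using assms by (simp add: norm_eq_sqrt_inner inner_eq_trace)
qed

lemma trace_diag_mat_mult: "trace (diag_mat d ** M) = (\<Sum>i\<in>UNIV. complex_of_real (d i) * M $ i $ i)"
  by (simp add: trace_def matrix_matrix_mult_def diag_mat_def if_distrib[of "\<lambda>x. x * _"] cong: if_cong)

text \<open>Cyclicity of the trace gives the trace of D (2 P - P^2), with P the Gram matrix of the
  rows of Y. Completing the square, 2 P - P^2 = 1 - (1 - P)^2, and as 1 - P is Hermitian, the
  diagonal of its square consists of squared row norms.\<close>

lemma E0_diagonalize:
  fixes U :: "complex^'n^'n" and X :: "complex^'m^'n"
  assumes U: "U ** ctranspose U = mat 1"
    and H: "H = U ** diag_mat d ** ctranspose U"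
  shows "E0 H X = diag_energy (\<lambda>i. - d i) (ctranspose U ** X)"
proof -
  define Y where "Y = ctranspose U ** X"
  define P where "P = Y ** ctranspose Y"
  let ?D = "diag_mat d"
  have X: "X = U ** Y" by (simp add: Y_def matrix_mul_assoc U)
  have UU: "ctranspose U ** U = mat 1" using U matrix_left_right_inverse by blast
  have XX: "ctranspose X ** X = ctranspose Y ** Y"
    by (metis X UU ctranspose_mult matrix_mul_assoc matrix_mul_lid)
  have XHX: "ctranspose X ** H ** X = ctranspose Y ** ?D ** Y"
    by (metis H Y_def ctranspose_mult ctranspose_ctranspose matrix_mul_assoc)
  have sm: "(mat 2 :: complex^'m^'m) = mat 1 + mat 1" by (simp add: mat_def vec_eq_iff)
  have "E0_trace H X = trace ((mat 1 + mat 1 - ctranspose Y ** Y) ** (ctranspose Y ** ?D ** Y))"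
    unfolding E0_trace_def XX XHX sm ..
  also have "(mat 1 + mat 1 - ctranspose Y ** Y) ** (ctranspose Y ** ?D ** Y)
      = ctranspose Y ** ?D ** Y + ctranspose Y ** ?D ** Y - ctranspose Y ** P ** ?D ** Y"
    by (simp only: matrix_diff_rdistrib matrix_add_rdistrib P_def matrix_mul_assoc matrix_mul_lid)
  also have "trace \<dots> = trace (ctranspose Y ** (?D ** Y)) + trace (ctranspose Y ** (?D ** Y))
      - trace ((ctranspose Y ** P) ** (?D ** Y))"
    by (simp only: trace_add trace_sub matrix_mul_assoc)
  also have "trace (ctranspose Y ** (?D ** Y)) = trace (?D ** P)"
    by (subst trace_mul_sym) (simp only: P_def matrix_mul_assoc)
  also have "trace ((ctranspose Y ** P) ** (?D ** Y)) = trace (?D ** (P ** P))"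
    by (subst trace_mul_sym) (simp only: P_def matrix_mul_assoc)
  also have "trace (?D ** P) + trace (?D ** P) - trace (?D ** (P ** P)) = trace (?D ** (P + P - P ** P))"
    by (simp only: matrix_diff_ldistrib matrix_add_ldistrib trace_add trace_sub)
  also have "P + P - P ** P = mat 1 - (mat 1 - P) ** (mat 1 - P)"
    by (simp add: matrix_diff_ldistrib matrix_diff_rdistrib)
  also have "\<dots> = mat 1 - (mat 1 - P) ** ctranspose (mat 1 - P)"
    by (simp add: ctranspose_diff P_def ctranspose_mult)
  finally show ?thesis
    unfolding E0_def diag_energy_def Y_def[symmetric] P_def[symmetric]
    by (simp add: trace_diag_mat_mult gram_diag mat_def algebra_simps)
qed

section \<open>Continuity, coercivity and first variation of the energy\<close>

lemma continuous_on_matrix_matrix_mult [continuous_intros]: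
  fixes f :: "'a::topological_space \<Rightarrow> complex^'n^'m" and g :: "'a \<Rightarrow> complex^'p^'n"
  assumes "continuous_on T f" "continuous_on T g"
  shows "continuous_on T (\<lambda>x. f x ** g x)"
  unfolding matrix_matrix_mult_def
  by (intro continuous_on_vec_lambda continuous_intros assms)

lemma continuous_on_ctranspose [continuous_intros]:
  assumes "continuous_on T f"
  shows "continuous_on T (\<lambda>x. ctranspose (f x))"
  unfolding ctranspose_def
  by (intro continuous_on_vec_lambda continuous_intros assms)

lemma continuous_on_E: "continuous_on T (E H \<mu>)"
proof -
  have "continuous_on T (\<lambda>X. E H \<mu> X)"
    unfolding E_def E0_def E0_trace_def l1_norm_def trace_def
    by (intro continuous_intros)
  then show ?thesis by simp
qed

lemma l1_norm_nonneg: "0 \<le> l1_norm X"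
  by (simp add: l1_norm_def sum_nonneg)

text \<open>Keep only the diagonal entry \<open>1 - t\<close> of row \<open>i\<close>, with
  \<open>t\<close> the squared norm of that row of \<open>Y\<close>; the bound
  \<open>2 * t - 4 \<le> (1 - t)\<^sup>2 - 1\<close> is \<open>(t - 2)\<^sup>2 \<ge> 0\<close>. This
  is what makes energy sublevel sets bounded.\<close>

lemma diag_energy_coercive:
  fixes Y :: "complex^'m^'n"
  assumes c: "0 < c" "\<And>i. c \<le> a i"
  shows "2 * c * (norm Y)\<^sup>2 \<le> diag_energy a Y + 4 * sum a UNIV"
proof -
  let ?P = "Y ** ctranspose Y"
  have "2 * c * (norm (Y $ i))\<^sup>2 \<le> a i * ((norm ((mat 1 - ?P) $ i))\<^sup>2 - 1) + 4 * a i" for i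
  proof -
    define t where "t = (norm (Y $ i))\<^sup>2"
    have "cmod ((mat 1 - ?P) $ i $ i) \<le> norm ((mat 1 - ?P) $ i)"
      by (rule Finite_Cartesian_Product.norm_nth_le)
    moreover have "(mat 1 - ?P) $ i $ i = complex_of_real (1 - t)"
      by (simp add: gram_diag mat_def t_def)
    ultimately have "\<bar>1 - t\<bar> \<le> norm ((mat 1 - ?P) $ i)" by (simp del: of_real_diff)
    then have "(1 - t)\<^sup>2 \<le> (norm ((mat 1 - ?P) $ i))\<^sup>2"
      by (simp add: power2_le_iff_abs_le)
    then have "(1 - t)\<^sup>2 - 1 \<le> (norm ((mat 1 - ?P) $ i))\<^sup>2 - 1" by simp
    moreover have "2 * t - 4 \<le> (1 - t)\<^sup>2 - 1"
      using zero_le_power2[of "t - 2"] by (simp add: power2_eq_square algebra_simps)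
    ultimately have "a i * (2 * t - 4) \<le> a i * ((norm ((mat 1 - ?P) $ i))\<^sup>2 - 1)"
      using c(1) c(2)[of i] by (intro mult_left_mono) linarith+
    moreover have "c * t \<le> a i * t" using c(2)[of i] by (intro mult_right_mono) (auto simp: t_def)
    ultimately show ?thesis by (simp add: t_def algebra_simps)
  qed
  then have "(\<Sum>i\<in>UNIV. 2 * c * (norm (Y $ i))\<^sup>2)
      \<le> (\<Sum>i\<in>UNIV. a i * ((norm ((mat 1 - ?P) $ i))\<^sup>2 - 1) + 4 * a i)"
    by (rule sum_mono)
  then show ?thesis
    by (simp add: diag_energy_def sum.distrib sum_distrib_left norm_eq_frobenius_rows)
qed

text \<open>First variation along \<open>R ** Y\<close>: as \<open>R\<close> is Hermitian and
  commutes with \<open>P\<close>, the derivative at 0 is -4 times the weighted sum of the squared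
  row norms of \<open>R ** Y\<close>. It vanishes at a minimizer, and positive weights then kill
  every row.\<close>

lemma diag_energy_minimizer_critical:
  fixes Y :: "complex^'m^'n"
  assumes a: "\<And>i. 0 < a i" and min: "\<And>Z :: complex^'m^'n. diag_energy a Y \<le> diag_energy a Z"
  shows "(mat 1 - Y ** ctranspose Y) ** Y = 0"
proof -
  define P where "P = Y ** ctranspose Y"
  define R where "R = mat 1 - P"
  define K where "K = R ** P"
  define Q where "Q = R ** P ** R"
  have hP: "ctranspose P = P" by (simp add: P_def ctranspose_mult)
  have hR: "ctranspose R = R" by (simp add: R_def ctranspose_diff hP)
  have comm: "P ** R = R ** P" by (simp add: R_def matrix_diff_ldistrib matrix_diff_rdistrib)
  have Yt: "mat 1 - (Y + t *\<^sub>R (R ** Y)) ** ctranspose (Y + t *\<^sub>R (R ** Y)) = R - (2 * t) *\<^sub>R K - t\<^sup>2 *\<^sub>R Q" for t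
  proof -
    have "ctranspose (Y + t *\<^sub>R (R ** Y)) = ctranspose Y + t *\<^sub>R (ctranspose Y ** R)"
      by (simp add: ctranspose_add ctranspose_scaleR ctranspose_mult hR)
    then have prod: "(Y + t *\<^sub>R (R ** Y)) ** ctranspose (Y + t *\<^sub>R (R ** Y))
       = P + t *\<^sub>R (R ** P) + t *\<^sub>R (P ** R) + t\<^sup>2 *\<^sub>R Q"
      by (simp add: matrix_add_ldistrib matrix_add_rdistrib matrix_scalar_ac scalar_matrix_assoc[symmetric]
        P_def Q_def matrix_mul_assoc power2_eq_square scaleR_add_right)
    have "(2 * t) *\<^sub>R K = t *\<^sub>R K + t *\<^sub>R K" by (simp only: mult_2 scaleR_left_distrib)
    then show ?thesis unfolding prod comm K_def[symmetric] by (simp add: R_def)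
  qed
  define h where "h t = diag_energy a (Y + t *\<^sub>R (R ** Y))" for t
  have h: "h t = (\<Sum>i\<in>UNIV. a i * ((norm (R $ i - (2 * t) *\<^sub>R K $ i - t\<^sup>2 *\<^sub>R Q $ i))\<^sup>2 - 1))" for t
    unfolding h_def diag_energy_def Yt by simp
  \<comment> \<open>\<open>K ** ctranspose R\<close> equals \<open>R ** P ** R\<close>, the Gram
    matrix of \<open>R ** Y\<close>; this gives the derivative a sign.\<close>
  have inn: "inner (R $ i) (K $ i) = (norm ((R ** Y) $ i))\<^sup>2" for i
  proof -
    have "K ** ctranspose R = (R ** Y) ** ctranspose (R ** Y)"
      by (simp add: K_def P_def hR ctranspose_mult matrix_mul_assoc)
    then show ?thesis by (simp add: inner_rows norm_row_square_gram)
  qed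
  have "(h has_real_derivative (\<Sum>i\<in>UNIV. a i * (-4 * inner (R $ i) (K $ i)))) (at 0)"
    unfolding h power2_norm_eq_inner[of "_ - _"]
    by (auto intro!: derivative_eq_intros sum.cong simp: inner_diff_left inner_diff_right inner_commute algebra_simps)
  moreover have "h 0 \<le> h t" for t
    using min by (simp add: h_def)
  ultimately have "(\<Sum>i\<in>UNIV. a i * (-4 * inner (R $ i) (K $ i))) = 0"
    by (intro DERIV_local_min[of h _ 0 1]) auto
  then have "(\<Sum>i\<in>UNIV. a i * (norm ((R ** Y) $ i))\<^sup>2) = 0"
    by (simp add: inn sum_negf mult.left_commute[of _ 4] flip: sum_distrib_left)
  then have "a i * (norm ((R ** Y) $ i))\<^sup>2 = 0" for i
    using less_imp_le[OF a] by (subst (asm) sum_nonneg_eq_0_iff) auto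
  then have "(R ** Y) $ i = 0" for i using a[of i] by (metis mult_eq_0_iff less_irrefl norm_eq_zero power_eq_0_iff)
  then show ?thesis by (simp add: vec_eq_iff R_def P_def)
qed

subsection \<open>Minimizers under the gap condition\<close>

definition coord_proj :: "'n set \<Rightarrow> complex^'n^'n" where
  "coord_proj I = (\<chi> i j. if i = j \<and> i \<in> I then 1 else 0)"

lemma norm_row_coord_proj_compl:
  "(norm ((mat 1 - coord_proj I :: complex^'n^'n) $ i))\<^sup>2 = (if i \<in> I then 0 else 1)"
proof -
  have "(cmod ((mat 1 - coord_proj I :: complex^'n^'n) $ i $ j))\<^sup>2 = (if j = i then (if i \<in> I then 0 else 1) else 0)" for j
    by (auto simp: coord_proj_def mat_def)
  then show ?thesis unfolding norm_row_square by simp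
qed

lemma diag_energy_coord_proj:
  assumes "Y ** ctranspose Y = coord_proj I"
  shows "diag_energy a Y = - sum a I"
proof -
  have "diag_energy a Y = (\<Sum>i\<in>UNIV. if i \<in> I then - a i else 0)"
    unfolding diag_energy_def assms norm_row_coord_proj_compl by (intro sum.cong) auto
  then show ?thesis by (simp add: sum.If_cases sum_negf)
qed

text \<open>Standard basis vectors placed in the rows indexed by \<open>I\<close> do it. The matrix
  is the competitor used in \<open>diag_energy_minimizer_frame\<close>.\<close>

lemma coord_proj_gram_exists:
  fixes I :: "'n::finite set"
  assumes "card I = CARD('m::finite)"
  shows "\<exists>V :: complex^'m^'n. V ** ctranspose V = coord_proj I"
proof -
  obtain t where t: "bij_betw t I (UNIV :: 'm set)"
    using assms finite_same_card_bij[of I "UNIV :: 'm set"] by auto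
  define V :: "complex^'m^'n" where "V = (\<chi> i j. if j = t i then (if i \<in> I then 1 else 0) else 0)"
  have "(V ** ctranspose V) $ i $ k = coord_proj I $ i $ k" for i k
  proof -
    have "(V ** ctranspose V) $ i $ k = (\<Sum>j\<in>UNIV. if j = t i then (if i \<in> I \<and> k \<in> I \<and> t i = t k then 1 else 0) else 0)"
      unfolding V_def matrix_matrix_mult_def ctranspose_def vec_lambda_beta by (rule sum.cong) auto
    then show ?thesis
      using t by (auto simp: coord_proj_def bij_betw_def inj_on_def)
  qed
  then show ?thesis by (intro exI[of _ V]) (simp add: vec_eq_iff)
qed

text \<open>For a Hermitian idempotent G the diagonal entry of row i equals the squared norm of that
  row, so G_ii = G_ii^2 + (squares of the off-diagonal entries). This confines G_ii to [0, 1] and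
  leaves no room for off-diagonal entries at the two extremes.\<close>

lemma idempotent_gram:
  fixes Z :: "complex^'p^'q"
  assumes idem: "(Z ** ctranspose Z) ** (Z ** ctranspose Z) = Z ** ctranspose Z"
  shows "(norm ((Z ** ctranspose Z) $ i))\<^sup>2 = (norm (Z $ i))\<^sup>2" (is ?A)
    and "(norm (Z $ i))\<^sup>2 \<le> 1" (is ?B)
    and "(norm (Z $ i))\<^sup>2 \<in> {0, 1} \<Longrightarrow> (Z ** ctranspose Z) $ i $ j = (if i = j then complex_of_real ((norm (Z $ i))\<^sup>2) else 0)"
proof -
  let ?G = "Z ** ctranspose Z" and ?p = "(norm (Z $ i))\<^sup>2"
  have "ctranspose ?G = ?G" by (simp add: ctranspose_mult)
  then show A: ?A using idem by (simp add: norm_row_square_gram[of ?G] gram_diag)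
  have "(cmod (?G $ i $ i))\<^sup>2 = ?p\<^sup>2" unfolding gram_diag norm_of_real power2_abs ..
  then have split: "?p = ?p\<^sup>2 + (\<Sum>j\<in>-{i}. (cmod (?G $ i $ j))\<^sup>2)"
    using A unfolding norm_row_square[of ?G] by (subst (asm) sum.remove[of _ i]) (auto simp: Compl_eq_Diff_UNIV)
  moreover have "0 \<le> (\<Sum>j\<in>-{i}. (cmod (?G $ i $ j))\<^sup>2)" by (rule sum_nonneg) simp
  ultimately have "?p\<^sup>2 \<le> ?p" by linarith
  then show ?B using power_strict_increasing[of 1 2 ?p] by (cases "?p \<le> 1") simp_all
  assume "?p \<in> {0, 1}"
  then have "?p\<^sup>2 = ?p" by (elim insertE emptyE) (simp_all only: power_one zero_power2)
  then have "(\<Sum>j\<in>-{i}. (cmod (?G $ i $ j))\<^sup>2) = 0" using split by linarith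
  then have "\<forall>j\<in>-{i}. (cmod (?G $ i $ j))\<^sup>2 = 0"
    by (subst (asm) sum_nonneg_eq_0_iff) auto
  then show "?G $ i $ j = (if i = j then complex_of_real ?p else 0)"
    by (cases "i = j") (simp_all add: gram_diag del: of_real_power)
qed

text \<open>A linear-programming argument. Criticality makes both Gram matrices of \<open>Y\<close>
  projections, so their diagonals \<open>p\<close> and \<open>q\<close> lie in [0, 1] and have equal
  sums; the energy is linear in \<open>p\<close>, and the gap \<open>b < A\<close> forces all mass
  onto \<open>I\<close>.\<close>

lemma diag_energy_minimizer_frame:
  fixes Y :: "complex^'m^'n"
  assumes a: "\<And>i. 0 < a i" and I: "card I = CARD('m)" and A: "0 < A" "b < A"
    and aI: "\<And>i. i \<in> I \<Longrightarrow> A \<le> a i" and aJ: "\<And>i. i \<notin> I \<Longrightarrow> a i \<le> b"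
    and min: "\<And>Z :: complex^'m^'n. diag_energy a Y \<le> diag_energy a Z"
  shows "ctranspose Y ** Y = mat 1" and "Y ** ctranspose Y = coord_proj I"
proof -
  define P where "P = Y ** ctranspose Y"
  define R where "R = mat 1 - P"
  have RY: "R ** Y = 0" using diag_energy_minimizer_critical[OF a min] by (simp add: R_def P_def)
  then have PY: "P ** Y = Y" by (simp add: R_def matrix_diff_rdistrib)
  then have PP: "P ** P = P" by (metis P_def matrix_mul_assoc)
  have hP: "ctranspose P = P" by (simp add: P_def ctranspose_mult)
  have hR: "ctranspose R = R" by (simp add: R_def ctranspose_diff hP)
  have RR: "R ** R = R" by (simp add: R_def matrix_diff_ldistrib matrix_diff_rdistrib PP)
  define p where "p i = (norm (Y $ i))\<^sup>2" for i
  define q where "q j = (norm (ctranspose Y $ j))\<^sup>2" for j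
  have MM: "(ctranspose Y ** Y) ** (ctranspose Y ** Y) = ctranspose Y ** Y"
    using PY by (simp add: P_def flip: matrix_mul_assoc)
  note idP = idempotent_gram[OF PP[unfolded P_def]]
  note idM = idempotent_gram[of "ctranspose Y", simplified, OF MM]
  have p: "0 \<le> p i" "p i \<le> 1" for i using idP(2) by (simp_all add: p_def)
  have q: "0 \<le> q j" "q j \<le> 1" for j using idM(2) by (simp_all add: q_def)
  have pq: "sum p UNIV = sum q UNIV"
    using norm_ctranspose[of Y] norm_eq_frobenius_rows[of Y] norm_eq_frobenius_rows[of "ctranspose Y"]
    by (simp add: p_def q_def)
  \<comment> \<open>\<open>R\<close> is a Hermitian idempotent, so its squared row norms are its
    diagonal entries \<open>1 - p i\<close>.\<close>
  have en: "diag_energy a Y = - (\<Sum>i\<in>UNIV. a i * p i)"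
  proof -
    have "(norm (R $ i))\<^sup>2 = 1 - p i" for i
      by (simp add: norm_row_square_gram[of R] hR RR) (simp add: R_def P_def gram_diag mat_def p_def)
    then show ?thesis
      unfolding diag_energy_def P_def[symmetric] R_def[symmetric] by (simp add: sum_negf)
  qed
  \<comment> \<open>Comparison with a frame supported on \<open>I\<close>: the mass missing on
    \<open>I\<close>, weighted by at least \<open>A\<close>, cannot exceed the mass outside,
    weighted by at most \<open>b\<close>.\<close>
  obtain V :: "complex^'m^'n" where "V ** ctranspose V = coord_proj I"
    using coord_proj_gram_exists[OF I] by blast
  then have "(\<Sum>i\<in>I. a i) \<le> (\<Sum>i\<in>UNIV. a i * p i)"
    using min[of V] by (simp add: diag_energy_coord_proj en)
  also have "\<dots> = (\<Sum>i\<in>I. a i * p i) + (\<Sum>i\<in>-I. a i * p i)"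
    by (metis Compl_eq_Diff_UNIV add.commute finite subset_UNIV sum.subset_diff)
  finally have "(\<Sum>i\<in>I. a i * (1 - p i)) \<le> (\<Sum>i\<in>-I. a i * p i)"
    by (simp add: right_diff_distrib sum_subtractf)
  moreover have "A * (\<Sum>i\<in>I. 1 - p i) \<le> (\<Sum>i\<in>I. a i * (1 - p i))"
    unfolding sum_distrib_left using aI p by (intro sum_mono mult_right_mono) auto
  moreover have "(\<Sum>i\<in>-I. a i * p i) \<le> b * (\<Sum>i\<in>-I. p i)"
    unfolding sum_distrib_left using aJ p by (intro sum_mono mult_right_mono) auto
  ultimately have le: "A * (\<Sum>i\<in>I. 1 - p i) \<le> b * (\<Sum>i\<in>-I. p i)" by linarith
  have "(\<Sum>i\<in>UNIV. p i) = (\<Sum>i\<in>I. p i) + (\<Sum>i\<in>-I. p i)"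
    by (metis Compl_eq_Diff_UNIV add.commute finite subset_UNIV sum.subset_diff)
  \<comment> \<open>Since \<open>card I = CARD('m)\<close>, the deficit on \<open>I\<close> is the
    mass outside plus the deficit of the column norms; with \<open>b < A\<close> all three sums must
    be zero.\<close>
  then have deficit: "(\<Sum>i\<in>I. 1 - p i) = (\<Sum>i\<in>-I. p i) + (\<Sum>j\<in>UNIV. 1 - q j)"
    using pq I by (simp add: sum_subtractf)
  have t0: "0 \<le> (\<Sum>i\<in>-I. p i)" using p by (intro sum_nonneg) auto
  have s0: "0 \<le> (\<Sum>j\<in>UNIV. 1 - q j)" using q by (intro sum_nonneg) auto
  have "A * (\<Sum>i\<in>-I. p i) + A * (\<Sum>j\<in>UNIV. 1 - q j) \<le> b * (\<Sum>i\<in>-I. p i)"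
    using le by (simp add: deficit distrib_left)
  then have sum_le: "(A - b) * (\<Sum>i\<in>-I. p i) + A * (\<Sum>j\<in>UNIV. 1 - q j) \<le> 0"
    by (simp add: left_diff_distrib)
  moreover have "0 \<le> (A - b) * (\<Sum>i\<in>-I. p i)" "0 \<le> A * (\<Sum>j\<in>UNIV. 1 - q j)"
    using A t0 s0 by auto
  ultimately have "(A - b) * (\<Sum>i\<in>-I. p i) = 0" "A * (\<Sum>j\<in>UNIV. 1 - q j) = 0" by linarith+
  then have z: "(\<Sum>i\<in>-I. p i) = 0" "(\<Sum>j\<in>UNIV. 1 - q j) = 0" using A by auto
  then have z3: "(\<Sum>i\<in>I. 1 - p i) = 0" using deficit by simp
  have pJ: "\<forall>i\<in>-I. p i = 0" using z(1) p by (subst (asm) sum_nonneg_eq_0_iff) auto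
  have q1: "\<forall>j\<in>UNIV. 1 - q j = 0" using z(2) q by (subst (asm) sum_nonneg_eq_0_iff) auto
  have pI: "\<forall>i\<in>I. 1 - p i = 0" using z3 p by (subst (asm) sum_nonneg_eq_0_iff) auto
  have "(ctranspose Y ** Y) $ i $ j = mat 1 $ i $ j" for i j
    using q1 idM(3)[of i j] by (simp add: q_def mat_def)
  then show "ctranspose Y ** Y = mat 1" by (simp add: vec_eq_iff)
  have "(Y ** ctranspose Y) $ i $ j = coord_proj I $ i $ j" for i j
    using pI pJ idP(3)[of i j] by (cases "i \<in> I") (auto simp: p_def coord_proj_def simp del: of_real_power)
  then show "Y ** ctranspose Y = coord_proj I" by (simp add: vec_eq_iff)
qed

subsection \<open>Quadratic growth\<close>

text \<open>Cauchy-Schwarz for each pair of rows. It controls the quadratic part \<open>Q\<close> of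
  the Gram matrix in \<open>diag_energy_growth\<close>.\<close>

lemma norm_gram_le: "norm ((W :: complex^'m^'n) ** ctranspose W) \<le> (norm W)\<^sup>2"
proof -
  have entry: "(cmod ((W ** ctranspose W) $ i $ j))\<^sup>2 \<le> (norm (W $ i))\<^sup>2 * (norm (W $ j))\<^sup>2" for i j
  proof -
    have "cmod ((W ** ctranspose W) $ i $ j) \<le> (\<Sum>k\<in>UNIV. cmod (W $ i $ k) * cmod (W $ j $ k))"
      unfolding matrix_matrix_mult_def ctranspose_def vec_lambda_beta
      by (rule order_trans[OF norm_sum]) (simp add: norm_mult)
    also have "\<dots> \<le> norm (W $ i) * norm (W $ j)"
      using L2_set_mult_ineq[of "\<lambda>k. cmod (W $ i $ k)" "\<lambda>k. cmod (W $ j $ k)" UNIV] by (simp add: norm_vec_def)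
    finally have "(cmod ((W ** ctranspose W) $ i $ j))\<^sup>2 \<le> (norm (W $ i) * norm (W $ j))\<^sup>2"
      by (rule power_mono) simp
    then show ?thesis by (simp add: power_mult_distrib)
  qed
  have "(norm (W ** ctranspose W))\<^sup>2 = (\<Sum>i\<in>UNIV. \<Sum>j\<in>UNIV. (cmod ((W ** ctranspose W) $ i $ j))\<^sup>2)"
    by (simp only: norm_eq_frobenius_rows norm_row_square)
  also have "\<dots> \<le> (\<Sum>i\<in>UNIV. \<Sum>j\<in>UNIV. (norm (W $ i))\<^sup>2 * (norm (W $ j))\<^sup>2)"
    by (intro sum_mono entry)
  also have "\<dots> = ((norm W)\<^sup>2)\<^sup>2"
    by (simp only: norm_eq_frobenius_rows sum_product power2_eq_square[of "sum _ _"])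
  finally show ?thesis by (simp only: power2_le_imp_le zero_le_power2)
qed

text \<open>The Gram matrix of \<open>Y\<close> is \<open>coord_proj I + L + Q\<close> with
  \<open>L\<close> linear and \<open>Q\<close> quadratic in \<open>W = Y - Y0\<close>. The
  second-order part of the excess is at least \<open>(A - b) * (norm W)\<^sup>2\<close>, and the
  error is cubic. The assumption \<open>herm\<close> rules out, to first order, displacement along
  the unitary orbit of \<open>Y0\<close>, on which the energy is constant.\<close>

lemma diag_energy_growth:
  fixes Y Y0 :: "complex^'m^'n"
  assumes a: "\<And>i. 0 \<le> a i" "\<And>i. a i \<le> M" and b: "0 \<le> b" "b \<le> A"
    and aI: "\<And>i. i \<in> I \<Longrightarrow> A \<le> a i" and aJ: "\<And>i. i \<notin> I \<Longrightarrow> a i \<le> b"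
    and frame: "ctranspose Y0 ** Y0 = mat 1" and proj: "Y0 ** ctranspose Y0 = coord_proj I"
    and herm: "ctranspose (ctranspose Y0 ** Y) = ctranspose Y0 ** Y"
  shows "(A - b - 4 * M * norm (Y - Y0)) * (norm (Y - Y0))\<^sup>2 \<le> diag_energy a Y + sum a I"
proof -
  define W where "W = Y - Y0"
  define T where "T = W ** ctranspose Y0"
  define L where "L = T + ctranspose T"
  define Q where "Q = W ** ctranspose W"
  define w where "w i = (norm (W $ i))\<^sup>2" for i
  have w0: "0 \<le> w i" for i by (simp add: w_def)
  have Y: "Y = Y0 + W" by (simp add: W_def)
  have P: "Y ** ctranspose Y = coord_proj I + L + Q"
    by (simp add: Y ctranspose_add matrix_add_ldistrib matrix_add_rdistrib proj L_def Q_def T_def ctranspose_mult algebra_simps)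
  have row0: "Y0 $ i = 0" if "i \<notin> I" for i
  proof -
    have "(norm (Y0 $ i))\<^sup>2 = 0" using that by (simp only: norm_row_square_gram proj) (simp add: coord_proj_def)
    then show ?thesis by simp
  qed
  have T0: "T $ i $ j = 0" if "j \<notin> I" for i j
    using row0[OF that] by (simp add: T_def matrix_matrix_mult_def ctranspose_def)
  have "T ** ctranspose T = W ** (ctranspose Y0 ** Y0) ** ctranspose W"
    by (simp add: T_def ctranspose_mult matrix_mul_assoc)
  then have normT: "(norm (T $ i))\<^sup>2 = w i" for i
    by (simp add: w_def norm_row_square_gram frame)
  \<comment> \<open>\<open>coord_proj I\<close> leaves the rows of \<open>T\<close> indexed by
    \<open>I\<close> unchanged, and \<open>Y0 ** N ** ctranspose Y0\<close> is Hermitian because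
    \<open>N\<close> is.\<close>
  have Tsym: "T $ i $ j = cnj (T $ j $ i)" if "i \<in> I" "j \<in> I" for i j
  proof -
    define N where "N = ctranspose Y0 ** W"
    have "N = ctranspose Y0 ** Y - mat 1" by (simp add: N_def W_def matrix_diff_ldistrib frame)
    then have hN: "ctranspose N = N" by (simp add: ctranspose_diff herm)
    have JT: "coord_proj I ** T = Y0 ** N ** ctranspose Y0"
      by (simp add: N_def T_def matrix_mul_assoc flip: proj)
    then have hJT: "ctranspose (coord_proj I ** T) = coord_proj I ** T"
      by (simp add: ctranspose_mult hN matrix_mul_assoc)
    have JTij: "(coord_proj I ** T) $ i $ j = T $ i $ j" if "i \<in> I" for i j
    proof -
      have "(coord_proj I ** T) $ i $ j = (\<Sum>k\<in>UNIV. if k = i then T $ i $ j else 0)"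
        unfolding matrix_matrix_mult_def coord_proj_def vec_lambda_beta using that by (intro sum.cong) auto
      then show ?thesis by simp
    qed
    have "ctranspose (coord_proj I ** T) $ i $ j = cnj ((coord_proj I ** T) $ j $ i)" by (simp add: ctranspose_def)
    then show ?thesis unfolding hJT JTij[OF that(1)] JTij[OF that(2)] .
  qed
  have Lij: "L $ i $ j = T $ i $ j + cnj (T $ j $ i)" for i j by (simp add: L_def ctranspose_def)
  have split: "sum f UNIV = sum f I + sum f (-I)" for f :: "'n \<Rightarrow> real"
    by (metis Compl_eq_Diff_UNIV add.commute finite subset_UNIV sum.subset_diff)

  \<comment> \<open>For \<open>i\<close> outside \<open>I\<close> column \<open>i\<close> of
    \<open>T\<close> vanishes, so row \<open>i\<close> of \<open>L\<close> is row \<open>i\<close>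
    of \<open>T\<close>.\<close>
  have LJ: "(norm (L $ i))\<^sup>2 = w i" if "i \<notin> I" for i
    using T0[OF that] by (simp only: norm_row_square Lij) (simp add: normT[symmetric] norm_row_square)
  \<comment> \<open>The block of \<open>T\<close> with rows outside \<open>I\<close> and columns in
    \<open>I\<close> enters \<open>L\<close> a second time through \<open>ctranspose T\<close>;
    \<open>u i\<close> is its share in row \<open>i\<close>. On \<open>I \<times> I\<close> the two
    summands of \<open>L\<close> agree, whence the factor 4 below.\<close>
  define u where "u i = (\<Sum>j\<in>-I. (cmod (T $ j $ i))\<^sup>2)" for i
  have LI: "(norm (L $ i))\<^sup>2 = 4 * w i + u i" if "i \<in> I" for i
  proof -
    have "(cmod (L $ i $ j))\<^sup>2 = 4 * (cmod (T $ i $ j))\<^sup>2" if "j \<in> I" for j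
    proof -
      have "L $ i $ j = 2 * T $ i $ j" using Tsym[OF \<open>i \<in> I\<close> that] by (simp add: Lij)
      then show ?thesis by (simp add: norm_mult power_mult_distrib)
    qed
    moreover have "(cmod (L $ i $ j))\<^sup>2 = (cmod (T $ j $ i))\<^sup>2" if "j \<in> -I" for j
      using T0[of j i] that by (simp add: Lij)
    moreover have "w i = (\<Sum>j\<in>I. (cmod (T $ i $ j))\<^sup>2)"
      unfolding normT[symmetric] norm_row_square split using T0[of _ i] by simp
    ultimately show ?thesis
      unfolding norm_row_square split u_def by (simp add: sum_distrib_left)
  qed
  have sum_u: "sum u I = sum w (-I)"
  proof -
    have "(\<Sum>i\<in>I. (cmod (T $ j $ i))\<^sup>2) = w j" for j
      unfolding normT[symmetric] norm_row_square split using T0[of _ j] by simp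
    then show ?thesis unfolding u_def by (subst sum.swap) simp
  qed

  have rowI: "(norm ((mat 1 - Y ** ctranspose Y) $ i))\<^sup>2 = (norm (L $ i + Q $ i))\<^sup>2" if "i \<in> I" for i
  proof -
    have "(mat 1 - coord_proj I :: complex^'n^'n) $ i = 0"
      using that by (auto simp: coord_proj_def mat_def vec_eq_iff)
    then have "(mat 1 - Y ** ctranspose Y) $ i = - (L $ i + Q $ i)" by (simp add: P)
    then show ?thesis by (simp only: norm_minus_cancel)
  qed
  \<comment> \<open>Here \<open>L $ i $ i\<close> is 0, so the inner product with the unit vector is
    just \<open>Q $ i $ i = w i\<close>. The resulting \<open>- 2 * w i\<close> outweighs the gain
    \<open>w i\<close> from \<open>L\<close> and leaves \<open>- w i\<close>.\<close>
  have rowJ: "(norm ((mat 1 - Y ** ctranspose Y) $ i))\<^sup>2 = 1 - 2 * w i + (norm (L $ i + Q $ i))\<^sup>2" if "i \<notin> I" for i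
  proof -
    have "(mat 1 - coord_proj I :: complex^'n^'n) $ i = axis i 1"
      using that by (auto simp: coord_proj_def mat_def vec_eq_iff axis_def)
    then have row: "(mat 1 - Y ** ctranspose Y) $ i = axis i 1 - (L $ i + Q $ i)"
      by (simp add: P algebra_simps)
    have "inner (axis i 1) (L $ i + Q $ i) = Re (L $ i $ i) + Re (Q $ i $ i)"
      by (simp add: inner_axis' inner_complex_def)
    also have "\<dots> = w i" using T0[OF that, of i] by (simp add: Lij Q_def gram_diag w_def)
    finally have "inner (axis i 1) (L $ i + Q $ i) = w i" .
    moreover have "(norm (x - y))\<^sup>2 = (norm x)\<^sup>2 - 2 * inner x y + (norm y)\<^sup>2" for x y :: "complex^'n"
      by (simp add: power2_norm_eq_inner inner_diff_left inner_diff_right inner_commute)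
    moreover have "norm (axis i (1 :: complex) :: complex^'n) = 1"
      by (simp add: norm_eq_sqrt_inner inner_axis_axis)
    ultimately show ?thesis unfolding row by simp
  qed
  \<comment> \<open>Cauchy-Schwarz, with the square of \<open>norm (Q $ i)\<close> dropped; what
    remains of \<open>Q\<close> is the cubic error collected in \<open>v\<close>.\<close>
  have cross: "(norm (L $ i))\<^sup>2 - 2 * (norm (L $ i) * norm (Q $ i)) \<le> (norm (L $ i + Q $ i))\<^sup>2" for i
  proof -
    have "(norm (L $ i + Q $ i))\<^sup>2 = (norm (L $ i))\<^sup>2 + 2 * inner (L $ i) (Q $ i) + (norm (Q $ i))\<^sup>2"
      by (simp add: power2_norm_eq_inner inner_add_left inner_add_right inner_commute)
    moreover have "- (norm (L $ i) * norm (Q $ i)) \<le> inner (L $ i) (Q $ i)"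
      using Cauchy_Schwarz_ineq2[of "L $ i" "Q $ i"] by linarith
    moreover have "0 \<le> (norm (Q $ i))\<^sup>2" by simp
    ultimately show ?thesis by linarith
  qed
  define v where "v i = norm (L $ i) * norm (Q $ i)" for i
  have v0: "0 \<le> v i" for i by (simp add: v_def)
  have sum_v: "sum v UNIV \<le> 2 * norm W * (norm W)\<^sup>2"
  proof -
    have "sum v UNIV \<le> norm L * norm Q"
      using L2_set_mult_ineq[of "\<lambda>i. norm (L $ i)" "\<lambda>i. norm (Q $ i)" UNIV] by (simp add: norm_vec_def[of L] norm_vec_def[of Q] v_def)
    also have "norm L \<le> 2 * norm W"
    proof -
      have "(norm T)\<^sup>2 = (norm W)\<^sup>2" by (simp only: norm_eq_frobenius_rows normT w_def)
      then have "norm T = norm W" by simp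
      then show ?thesis using norm_triangle_ineq[of T "ctranspose T"] by (simp add: L_def norm_ctranspose)
    qed
    then have "norm L * norm Q \<le> (2 * norm W) * (norm W)\<^sup>2"
      using norm_gram_le[of W] by (intro mult_mono) (auto simp: Q_def)
    finally show ?thesis .
  qed
  have termI: "A * (4 * w i + u i) - 2 * M * v i \<le> a i * ((norm ((mat 1 - Y ** ctranspose Y) $ i))\<^sup>2 - 1) + a i" if "i \<in> I" for i
  proof -
    have "A * (4 * w i + u i) \<le> a i * (4 * w i + u i)"
      using aI[OF that] w0[of i] by (intro mult_right_mono) (auto simp: u_def sum_nonneg)
    moreover have "a i * (2 * v i) \<le> M * (2 * v i)" using a v0[of i] by (intro mult_right_mono) auto
    moreover have "a i * (4 * w i + u i - 2 * v i) \<le> a i * (norm (L $ i + Q $ i))\<^sup>2"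
      using cross[of i] LI[OF that] a by (intro mult_left_mono) (auto simp: v_def)
    ultimately show ?thesis unfolding rowI[OF that] by (simp add: algebra_simps)
  qed
  have termJ: "- b * w i - 2 * M * v i \<le> a i * ((norm ((mat 1 - Y ** ctranspose Y) $ i))\<^sup>2 - 1)" if "i \<notin> I" for i
  proof -
    have "a i * w i \<le> b * w i"
      using aJ[OF that] w0[of i] by (intro mult_right_mono) auto
    moreover have "a i * (2 * v i) \<le> M * (2 * v i)" using a v0[of i] by (intro mult_right_mono) auto
    moreover have "a i * (w i - 2 * v i) \<le> a i * (norm (L $ i + Q $ i))\<^sup>2"
      using cross[of i] LJ[OF that] a by (intro mult_left_mono) (auto simp: v_def)
    ultimately show ?thesis unfolding rowJ[OF that] by (simp add: algebra_simps)
  qed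
  have "(\<Sum>i\<in>I. A * (4 * w i + u i) - 2 * M * v i) + (\<Sum>i\<in>-I. - b * w i - 2 * M * v i)
    \<le> (\<Sum>i\<in>I. a i * ((norm ((mat 1 - Y ** ctranspose Y) $ i))\<^sup>2 - 1) + a i)
      + (\<Sum>i\<in>-I. a i * ((norm ((mat 1 - Y ** ctranspose Y) $ i))\<^sup>2 - 1))"
    by (intro add_mono sum_mono termI termJ) auto
  also have "\<dots> = diag_energy a Y + sum a I"
    unfolding diag_energy_def split by (simp add: sum.distrib)
  \<comment> \<open>By \<open>sum_u\<close> the mass \<open>u\<close> on \<open>I\<close> equals the
    mass \<open>w\<close> outside, which turns the coefficient \<open>- b\<close> there into
    \<open>A - b\<close>.\<close>
  also have "(\<Sum>i\<in>I. A * (4 * w i + u i) - 2 * M * v i) + (\<Sum>i\<in>-I. - b * w i - 2 * M * v i)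
     = 4 * A * sum w I + (A - b) * sum w (-I) - 2 * M * sum v UNIV"
    unfolding split sum_subtractf sum_distrib_left[symmetric] sum.distrib sum_u by (simp add: algebra_simps)
  finally have main: "4 * A * sum w I + (A - b) * sum w (-I) - 2 * M * sum v UNIV \<le> diag_energy a Y + sum a I" .
  \<comment> \<open>The coefficient \<open>A - b\<close> is the smaller of the two, so it can serve
    for all rows.\<close>
  have "(A - b) * sum w I \<le> 4 * A * sum w I"
    using b w0 by (intro mult_right_mono sum_nonneg) auto
  moreover have "(norm W)\<^sup>2 = sum w I + sum w (-I)"
    unfolding norm_eq_frobenius_rows by (simp add: split w_def)
  moreover have "0 \<le> M" using a order_trans by blast
  then have "2 * M * sum v UNIV \<le> 2 * M * (2 * norm W * (norm W)\<^sup>2)"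
    using sum_v by (intro mult_left_mono) auto
  ultimately show ?thesis using main unfolding W_def[symmetric] by (simp add: algebra_simps)
qed

subsection \<open>Nearest minimizers and sparsity\<close>

lemma norm_mult_unitary:
  fixes U :: "complex^'m^'m" and X :: "complex^'m^'n"
  assumes "U ** ctranspose U = mat 1"
  shows "norm (X ** U) = norm X"
  using norm_unitary_mult[of "ctranspose U" "ctranspose X"] assms
  by (simp add: norm_ctranspose flip: ctranspose_mult)

text \<open>Polarization: reality of the form at \<open>x\<close>, \<open>y\<close> and
  \<open>x + y\<close> makes \<open>B x y + B y x\<close> real, and coordinate vectors then read off
  the entries.\<close>

lemma hermitian_if_quadratic_form_real:
  fixes Z :: "complex^'m^'m"
  assumes real: "\<And>u. Im (\<Sum>i\<in>UNIV. cnj (u $ i) * (Z *v u) $ i) = 0"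
  shows "ctranspose Z = Z"
proof -
  define B where "B x y = (\<Sum>i\<in>UNIV. cnj (x $ i) * (Z *v y) $ i)" for x y
  have add: "B (x + y) (x + y) = B x x + B x y + B y x + B y y" for x y
    by (simp add: B_def matrix_vector_right_distrib algebra_simps sum.distrib)
  have axis: "B (axis j c) (axis k d) = cnj c * (Z $ j $ k * d)" for j k c d
  proof -
    have "(Z *v axis k d) $ i = Z $ i $ k * d" for i
      unfolding matrix_vector_mult_def axis_def vec_lambda_beta by (simp add: mult_delta_right)
    then have "B (axis j c) (axis k d) = (\<Sum>i\<in>UNIV. if i = j then cnj c * (Z $ j $ k * d) else 0)"
      unfolding B_def by (intro sum.cong) (auto simp: axis_def)
    then show ?thesis by simp
  qed
  have "Im (B x y + B y x) = 0" for x y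
    using real[of "x + y"] real[of x] real[of y] unfolding B_def[symmetric] add by simp
  \<comment> \<open>The scalars 1 and \<open>\<i>\<close> give the imaginary part of the sum and the
    real part of the difference of two mirrored entries.\<close>
  from this[of "axis j 1" "axis k 1" for j k] this[of "axis j 1" "axis k \<i>" for j k]
  have "Im (Z $ j $ k + Z $ k $ j) = 0" "Re (Z $ j $ k - Z $ k $ j) = 0" for j k
    by (simp_all add: axis)
  then have "cnj (Z $ k $ j) = Z $ j $ k" for j k
    by (metis add.inverse_unique complex_cnj complex_surj diff_eq_eq add_0 minus_complex.sel(1) plus_complex.sel(2))
  then show ?thesis by (simp add: ctranspose_def vec_eq_iff)
qed

text \<open>Testing the unitaries \<open>1 + (e - 1) u u* / |u|\<^sup>2\<close> with \<open>|e| = 1\<close> shows that every value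
  of the quadratic form of \<open>X0* X\<close> is real.\<close>

lemma nearest_orbit_point_hermitian:
  fixes X X0 :: "complex^'m^'n"
  assumes nearest: "\<And>U :: complex^'m^'m. U ** ctranspose U = mat 1 \<Longrightarrow> norm (X - X0) \<le> norm (X - X0 ** U)"
  shows "ctranspose (ctranspose X0 ** X) = ctranspose X0 ** X"
proof (rule hermitian_if_quadratic_form_real)
  fix u :: "complex^'m"
  define Z where "Z = ctranspose X0 ** X"
  define s where "s = (\<Sum>i\<in>UNIV. cnj (u $ i) * (Z *v u) $ i)"
  show "Im (\<Sum>i\<in>UNIV. cnj (u $ i) * ((ctranspose X0 ** X) *v u) $ i) = 0"
  proof (cases "s = 0")
    case False
    then have "u \<noteq> 0" by (auto simp: s_def)
    define n where "n = (norm u)\<^sup>2"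
    have n: "n > 0" using \<open>u \<noteq> 0\<close> by (simp add: n_def)
    have nsum: "(\<Sum>k\<in>UNIV. u $ k * cnj (u $ k)) = complex_of_real n"
      unfolding n_def norm_vec_def L2_set_def by (simp add: sum_nonneg complex_norm_square del: of_real_power)
    \<comment> \<open>The phase of \<open>s\<close>: it turns \<open>cnj s\<close> into
      \<open>cmod s\<close>, so the optimality condition at the end reads
      \<open>cmod s \<le> Re s\<close>, which only a real \<open>s\<close> satisfies.\<close>
    define e where "e = s / complex_of_real (cmod s)"
    have e: "e * cnj e = 1"
      using False by (simp add: e_def complex_norm_square[symmetric] power2_eq_square field_simps)
    define c where "c = (e - 1) / complex_of_real n"
    \<comment> \<open>This scalar identity is the unitarity of \<open>mat 1 + G\<close>, since
      \<open>G\<close> is \<open>c\<close> times the rank-one matrix built from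
      \<open>u\<close>.\<close>
    have c: "c + cnj c + c * cnj c * complex_of_real n = 0"
      using n e by (simp add: c_def field_simps)
    define G :: "complex^'m^'m" where "G = (\<chi> i j. c * (u $ i * cnj (u $ j)))"
    have "((mat 1 + G) ** ctranspose (mat 1 + G)) $ i $ j = mat 1 $ i $ j" for i j
    proof -
      have "(G ** ctranspose G) $ i $ j = (\<Sum>k\<in>UNIV. (c * cnj c * (u $ i * cnj (u $ j))) * (u $ k * cnj (u $ k)))"
        by (simp add: matrix_matrix_mult_def ctranspose_def G_def mult_ac)
      also have "\<dots> = (c * cnj c * (u $ i * cnj (u $ j))) * complex_of_real n"
        by (simp only: sum_distrib_left[symmetric] nsum)
      finally have "(G + ctranspose G + G ** ctranspose G) $ i $ j
          = (c + cnj c + c * cnj c * complex_of_real n) * (u $ i * cnj (u $ j))"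
        by (simp add: G_def ctranspose_def algebra_simps)
      then have "(G + ctranspose G + G ** ctranspose G) $ i $ j = 0" by (simp add: c)
      then show ?thesis
        by (simp add: ctranspose_add matrix_add_ldistrib matrix_add_rdistrib add.assoc)
    qed
    then have U: "(mat 1 + G) ** ctranspose (mat 1 + G) = mat 1" by (simp add: vec_eq_iff)
    have X0U: "X0 ** (mat 1 + G) = X0 + X0 ** G" by (simp add: matrix_add_ldistrib)
    \<comment> \<open>A unitary factor preserves the norm of \<open>X0\<close>, so being nearest to
      \<open>X\<close> means having the largest inner product with it.\<close>
    have "inner X (X0 + X0 ** G) \<le> inner X X0"
    proof -
      have "(norm (X - X0))\<^sup>2 \<le> (norm (X - (X0 + X0 ** G)))\<^sup>2"
        using nearest[OF U] by (intro power_mono) (auto simp: X0U)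
      moreover have "(norm (X0 + X0 ** G))\<^sup>2 = (norm X0)\<^sup>2"
        using norm_mult_unitary[OF U, of X0] by (simp only: X0U)
      moreover have "(norm (x - y))\<^sup>2 = (norm x)\<^sup>2 - 2 * inner x y + (norm y)\<^sup>2" for x y :: "complex^'m^'n"
        by (simp add: power2_norm_eq_inner inner_diff_left inner_diff_right inner_commute)
      ultimately show ?thesis by simp
    qed
    then have "inner X (X0 ** G) \<le> 0" by (simp add: inner_add_right)
    also have "inner X (X0 ** G) = inner Z G"
      by (simp add: inner_eq_trace Z_def ctranspose_mult matrix_mul_assoc)
    also have "inner Z G = Re (c * cnj s)"
    proof -
      have "inner Z G = Re (\<Sum>i\<in>UNIV. \<Sum>j\<in>UNIV. cnj (Z $ i $ j) * (c * (u $ i * cnj (u $ j))))"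
        by (simp only: inner_vec_def[of Z] inner_complex_vec Re_sum G_def vec_lambda_beta)
      also have "(\<Sum>i\<in>UNIV. \<Sum>j\<in>UNIV. cnj (Z $ i $ j) * (c * (u $ i * cnj (u $ j)))) = c * cnj s"
        by (simp add: s_def matrix_vector_mult_def sum_distrib_left mult_ac)
      finally show ?thesis .
    qed
    also have "c * cnj s = (complex_of_real (cmod s) - cnj s) / complex_of_real n"
    proof -
      have "e * cnj s = complex_of_real (cmod s)"
        using False by (simp add: e_def complex_norm_square[symmetric] power2_eq_square)
      then show ?thesis by (simp add: c_def left_diff_distrib)
    qed
    finally have "cmod s \<le> Re s"
      using n by (simp add: divide_le_0_iff)
    then have "(cmod s)\<^sup>2 \<le> (Re s)\<^sup>2" by (rule power_mono) simp
    then have "Im s = 0" by (simp add: cmod_power2)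
    then show ?thesis by (simp add: s_def Z_def)
  qed (simp add: s_def Z_def)
qed

section \<open>The entrywise l1 norm and its bound by the number of nonzero entries\<close>

lemma l1_norm_triangle: "l1_norm X - l1_norm Y \<le> l1_norm (X - Y)"
  unfolding l1_norm_def sum_subtractf[symmetric]
  by (intro sum_mono) (simp add: norm_triangle_ineq2)

text \<open>Cauchy-Schwarz against the indicator of the support; this is where the sparsity count
  enters the final bound.\<close>

lemma l1_norm_le_nnz: "l1_norm (X :: complex^'m^'n) \<le> sqrt (nnz X) * norm X"
proof -
  define P where "P = {(i, j). X $ i $ j \<noteq> 0}"
  let ?f = "\<lambda>p. cmod (X $ fst p $ snd p)"
  have "l1_norm X = (\<Sum>p\<in>UNIV. ?f p)"
    by (simp add: l1_norm_def sum.cartesian_product case_prod_unfold)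
  also have "\<dots> = (\<Sum>p\<in>P. ?f p)"
    by (rule sum.mono_neutral_right) (auto simp: P_def)
  also have "\<dots> = (\<Sum>p\<in>P. \<bar>1\<bar> * \<bar>?f p\<bar>)" by simp
  also have "\<dots> \<le> L2_set (\<lambda>p. 1) P * L2_set ?f P" by (rule L2_set_mult_ineq)
  also have "L2_set (\<lambda>p. 1) P = sqrt (nnz X)" by (simp add: L2_set_def nnz_def P_def)
  also have "L2_set ?f P \<le> norm X"
  proof -
    have "(\<Sum>p\<in>P. (?f p)\<^sup>2) \<le> (\<Sum>p\<in>UNIV. (?f p)\<^sup>2)" by (rule sum_mono2) auto
    also have "\<dots> = (\<Sum>i\<in>UNIV. \<Sum>j\<in>UNIV. (cmod (X $ i $ j))\<^sup>2)"
      by (simp add: sum.cartesian_product case_prod_unfold)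
    finally show ?thesis unfolding L2_set_def norm_eq_frobenius by (rule real_sqrt_le_mono)
  qed
  finally show ?thesis by (simp add: mult_left_mono)
qed

lemma nnz_le: "nnz (X :: complex^'m^'n) \<le> CARD('n) * CARD('m)"
proof -
  have "nnz X \<le> card (UNIV :: ('n \<times> 'm) set)" unfolding nnz_def by (rule card_mono) auto
  then show ?thesis by (simp add: card_cartesian_product flip: UNIV_Times_UNIV)
qed

subsection \<open>Compactness and the final estimates\<close>

lemma mem_minimizers_iff: "x \<in> minimizers f A \<longleftrightarrow> x \<in> A \<and> (\<forall>y\<in>A. f x \<le> f y)"
  by (auto simp: minimizers_def is_arg_min_linorder)

lemma compact_minimizers_nonempty:
  fixes f :: "'a::topological_space \<Rightarrow> real"
  assumes "compact A" "A \<noteq> {}" "continuous_on A f"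
  shows "minimizers f A \<noteq> {}"
  using continuous_attains_inf[OF assms] unfolding ex_in_conv[symmetric] mem_minimizers_iff by blast

lemma minimizers_nat_nonempty:
  fixes f :: "'a \<Rightarrow> nat"
  assumes "A \<noteq> {}"
  shows "minimizers f A \<noteq> {}"
proof -
  obtain x where "x \<in> A" using assms by blast
  from arg_min_nat_lemma[of "\<lambda>y. y \<in> A", OF this, of f] show ?thesis
    unfolding ex_in_conv[symmetric] mem_minimizers_iff by blast
qed

lemma continuous_on_l1_norm: "continuous_on T l1_norm"
proof -
  have "continuous_on T (\<lambda>X. l1_norm X)"
    unfolding l1_norm_def by (intro continuous_intros)
  then show ?thesis by simp
qed

text \<open>In eigencoordinates \<open>diag_energy_coercive\<close> bounds the norm, with
  \<open>c\<close> the least negated eigenvalue; the penalty is nonnegative and can only shrink the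
  set.\<close>

lemma compact_E_sublevel:
  fixes H :: "complex^'n^'n"
  assumes H: "hermitian H" "ordered_eigenvalues H ev" "ev CARD('n) < 0" and "0 \<le> \<mu>"
  shows "compact {X :: complex^'m^'n. E H \<mu> X \<le> C}"
proof -
  obtain U :: "complex^'n^'n" and s where U: "ctranspose U ** U = mat 1" "U ** ctranspose U = mat 1"
    and HU: "H = U ** diag_mat (\<lambda>i. ev (s i)) ** ctranspose U" and s: "bij_betw s (UNIV :: 'n set) {1..CARD('n)}"
    using hermitian_ordered_diagonalization[OF H(1,2)] .
  let ?a = "\<lambda>i. - ev (s i)"
  define c where "c = - ev CARD('n)"
  have c: "0 < c" using H(3) by (simp add: c_def)
  have ca: "c \<le> ?a i" for i
  proof -
    have "s i \<in> {1..CARD('n)}" using s by (auto simp: bij_betw_def)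
    then show ?thesis
      using H(2) by (auto simp: ordered_eigenvalues_def c_def intro!: mono_onD[of "{1..CARD('n)}" ev])
  qed
  have "norm X \<le> 1 + (C + 4 * sum ?a UNIV) / (2 * c)" if "E H \<mu> X \<le> C" for X :: "complex^'m^'n"
  proof -
    have "2 * c * (norm (ctranspose U ** X))\<^sup>2 \<le> diag_energy ?a (ctranspose U ** X) + 4 * sum ?a UNIV"
      by (rule diag_energy_coercive[OF c ca])
    also have "diag_energy ?a (ctranspose U ** X) = E0 H X" by (rule E0_diagonalize[OF U(2) HU, symmetric])
    also have "E0 H X \<le> C" using that \<open>0 \<le> \<mu>\<close> l1_norm_nonneg[of X] unfolding E_def
      by (meson le_add_same_cancel1 mult_nonneg_nonneg order_trans)
    finally have "2 * c * (norm X)\<^sup>2 \<le> C + 4 * sum ?a UNIV"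
      using norm_unitary_mult[of "ctranspose U" X] U by simp
    then have "(norm X)\<^sup>2 \<le> (C + 4 * sum ?a UNIV) / (2 * c)" using c by (simp add: pos_le_divide_eq mult.commute)
    moreover have "norm X \<le> 1 + (norm X)\<^sup>2"
      using zero_le_power2[of "norm X - 1"] norm_ge_zero[of X] unfolding power2_diff power_one mult_1_right by linarith
    ultimately show ?thesis by linarith
  qed
  then have "bounded {X :: complex^'m^'n. E H \<mu> X \<le> C}" by (auto simp: bounded_iff)
  moreover have "closed {X :: complex^'m^'n. E H \<mu> X \<le> C}"
    by (intro closed_Collect_le continuous_on_E continuous_on_const)
  ultimately show ?thesis by (simp add: compact_eq_bounded_closed)
qed

section \<open>Existence, compactness and stability of the minimizer sets\<close>

lemma mem_S_iff: "(X :: complex^'m^'n) \<in> S H \<mu> \<longleftrightarrow> (\<forall>Z :: complex^'m^'n. E H \<mu> X \<le> E H \<mu> Z)"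
  by (simp add: S_def mem_minimizers_iff)

lemma S_nonempty:
  fixes H :: "complex^'n^'n"
  assumes H: "hermitian H" "ordered_eigenvalues H ev" "ev CARD('n) < 0" and "0 \<le> \<mu>"
  shows "(S H \<mu> :: (complex^'m^'n) set) \<noteq> {}"
proof -
  \<comment> \<open>Points outside the compact sublevel set through 0 have larger energy than 0, so
    a minimizer over \<open>?K\<close> is global.\<close>
  let ?K = "{X :: complex^'m^'n. E H \<mu> X \<le> E H \<mu> (0 :: complex^'m^'n)}"
  have "minimizers (E H \<mu>) ?K \<noteq> {}"
    by (rule compact_minimizers_nonempty[OF compact_E_sublevel[OF assms] _ continuous_on_E]) auto
  then obtain X where X: "X \<in> ?K" "\<And>Z. Z \<in> ?K \<Longrightarrow> E H \<mu> X \<le> E H \<mu> Z"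
    unfolding ex_in_conv[symmetric] mem_minimizers_iff by blast
  have "E H \<mu> X \<le> E H \<mu> Z" for Z :: "complex^'m^'n"
  proof (cases "Z \<in> ?K")
    case False
    then show ?thesis using X(1) by simp
  qed (use X in blast)
  then have "X \<in> S H \<mu>" by (simp add: mem_S_iff)
  then show ?thesis by blast
qed

lemma compact_S:
  fixes H :: "complex^'n^'n"
  assumes H: "hermitian H" "ordered_eigenvalues H ev" "ev CARD('n) < 0" and "0 \<le> \<mu>"
  shows "compact (S H \<mu> :: (complex^'m^'n) set)"
proof -
  obtain X :: "complex^'m^'n" where X: "X \<in> S H \<mu>" using S_nonempty[OF assms] by blast
  have "S H \<mu> = {Z :: complex^'m^'n. E H \<mu> Z \<le> E H \<mu> X}"
    using X unfolding set_eq_iff mem_S_iff mem_Collect_eq by (meson order_trans)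
  then show ?thesis using compact_E_sublevel[OF assms] by simp
qed

text \<open>Compactness: \<open>K\<close> collects the points of bounded energy at distance at least
  \<open>\<delta>\<close> from every minimizer. The least excess on \<open>K\<close> is positive
  and, capped at 1, serves as \<open>\<eta>\<close>; if \<open>K\<close> is empty, 1 does.\<close>

lemma small_E0_excess_near_S:
  fixes H :: "complex^'n^'n" and G :: "complex^'m^'n"
  assumes H: "hermitian H" "ordered_eigenvalues H ev" "ev CARD('n) < 0"
    and G: "G \<in> S H 0" and d: "0 < \<delta>"
  shows "\<exists>\<eta>>0. \<forall>X :: complex^'m^'n. E0 H X - E0 H G < \<eta> \<longrightarrow> (\<exists>X0\<in>S H 0. norm (X - X0) < \<delta>)"
proof -
  define K where "K = {X :: complex^'m^'n. E0 H X \<le> E0 H G + 1} \<inter> (\<Inter>X0\<in>S H 0. {X. \<delta> \<le> norm (X - X0)})"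
  have "compact K" unfolding K_def
    using compact_E_sublevel[OF H order_refl, of "E0 H G + 1"]
    by (intro compact_Int_closed closed_INT ballI closed_Collect_le continuous_intros) simp_all
  show ?thesis
  proof (cases "K = {}")
    case True
    have "\<exists>X0\<in>S H 0. norm (X - X0) < \<delta>" if "E0 H X - E0 H G < 1" for X :: "complex^'m^'n"
    proof (rule ccontr)
      assume "\<not> ?thesis"
      then have "X \<in> K" using that by (auto simp: K_def not_less)
      then show False using True by blast
    qed
    then show ?thesis by (intro exI[of _ 1]) auto
  next
    case False
    have "continuous_on K (E0 H)" using continuous_on_E[of K H 0] by simp
    from compact_minimizers_nonempty[OF \<open>compact K\<close> False this]
    obtain X1 where X1: "X1 \<in> K" "\<And>X. X \<in> K \<Longrightarrow> E0 H X1 \<le> E0 H X"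
      unfolding ex_in_conv[symmetric] mem_minimizers_iff by blast
    \<comment> \<open>Otherwise \<open>X1\<close> would be a minimizer itself, at distance 0 from
      \<open>S H 0\<close>.\<close>
    have "E0 H G < E0 H X1"
    proof (rule ccontr)
      assume "\<not> ?thesis"
      then have "E0 H X1 \<le> E0 H G" by simp
      then have "X1 \<in> S H 0" using G unfolding mem_S_iff E_0 by (meson order_trans)
      then have "\<delta> \<le> norm (X1 - X1)" using X1(1) by (auto simp: K_def)
      then show False using d by simp
    qed
    moreover have "\<exists>X0\<in>S H 0. norm (X - X0) < \<delta>" if "E0 H X - E0 H G < min 1 (E0 H X1 - E0 H G)" for X :: "complex^'m^'n"
    proof (rule ccontr)
      assume "\<not> ?thesis"
      then have "X \<in> K" using that by (auto simp: K_def not_less)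
      then show False using X1(2)[of X] that by simp
    qed
    ultimately show ?thesis by (intro exI[of _ "min 1 (E0 H X1 - E0 H G)"]) auto
  qed
qed

text \<open>In eigencoordinates the energy depends only on the Gram matrix of the rows, which a
  unitary right factor cancels out of. Hence a minimizer nearest to a point is also nearest within
  its own unitary orbit.\<close>

lemma S_0_mult_unitary:
  fixes H :: "complex^'n^'n" and X :: "complex^'m^'n" and W :: "complex^'m^'m"
  assumes "hermitian H" and X: "X \<in> S H 0" and W: "W ** ctranspose W = mat 1"
  shows "X ** W \<in> S H 0"
proof -
  obtain U :: "complex^'n^'n" and d where "ctranspose U ** U = mat 1" and U: "U ** ctranspose U = mat 1" "H = U ** diag_mat d ** ctranspose U"
    using hermitian_diagonalization[OF assms(1)] .
  let ?Y = "ctranspose U ** X"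
  have "(?Y ** W) ** ctranspose (?Y ** W) = ?Y ** (W ** ctranspose W) ** ctranspose ?Y"
    by (simp add: ctranspose_mult matrix_mul_assoc)
  then have "diag_energy (\<lambda>i. - d i) (?Y ** W) = diag_energy (\<lambda>i. - d i) ?Y"
    unfolding diag_energy_def by (simp add: W)
  then have "E0 H (X ** W) = E0 H X"
    by (simp add: E0_diagonalize[OF U] matrix_mul_assoc)
  then show ?thesis using X by (simp add: mem_S_iff)
qed

text \<open>Passing to eigencoordinates preserves distances and minimality, so
  \<open>diag_energy_growth\<close> applies; on a small enough ball the cubic error costs at most
  the fraction \<open>1 - \<alpha>\<close> of the gap.\<close>

lemma E0_quadratic_growth:
  fixes H :: "complex^'n^'n" and ev :: "nat \<Rightarrow> real"
  assumes H: "hermitian H" "ordered_eigenvalues H ev" "ev CARD('n) < 0"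
    and gap: "CARD('m) < CARD('n)" "ev CARD('m) < ev (CARD('m) + 1)" and \<alpha>: "\<alpha> < 1"
  shows "\<exists>\<delta>>0. \<forall>X X0 :: complex^'m^'n. X0 \<in> minimizers (\<lambda>G. norm (X - G)) (S H 0) \<longrightarrow> norm (X - X0) < \<delta> \<longrightarrow>
    \<alpha> * (ev (CARD('m) + 1) - ev CARD('m)) * (norm (X - X0))\<^sup>2 \<le> E0 H X - E0 H X0"
proof -
  obtain U :: "complex^'n^'n" and s where U: "ctranspose U ** U = mat 1" "U ** ctranspose U = mat 1"
    and HU: "H = U ** diag_mat (\<lambda>i. ev (s i)) ** ctranspose U" and s: "bij_betw s (UNIV :: 'n set) {1..CARD('n)}"
    using hermitian_ordered_diagonalization[OF H(1,2)] .
  define m where "m = CARD('m)"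
  define a where "a i = - ev (s i)" for i
  \<comment> \<open>The coordinates of the \<open>m\<close> lowest eigenvalues; negation makes their
    weights the largest, separated from the others by \<open>b < A\<close>.\<close>
  define I where "I = {i. s i \<le> m}"
  define A where "A = - ev m"
  define b where "b = - ev (m + 1)"
  define M where "M = sum a UNIV"
  have m: "1 \<le> m" "m < CARD('n)" using gap by (simp_all add: m_def Suc_le_eq)
  have s_range: "s i \<in> {1..CARD('n)}" for i using s by (auto simp: bij_betw_def)
  have mono: "ev j \<le> ev k" if "1 \<le> j" "j \<le> k" "k \<le> CARD('n)" for j k
    using H(2) that by (auto simp: ordered_eigenvalues_def intro!: mono_onD[of "{1..CARD('n)}" ev])
  have b0: "0 < b" using mono[of "m + 1" "CARD('n)"] m H(3) by (simp add: b_def)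
  have bA: "b < A" using gap by (simp add: b_def A_def m_def)
  have a0: "0 < a i" for i using mono[of "s i" "CARD('n)"] s_range[of i] H(3) by (simp add: a_def)
  have aM: "a i \<le> M" for i unfolding M_def using a0 by (intro member_le_sum) (auto intro: less_imp_le)
  have M: "0 < M" using less_le_trans[OF a0 aM] .
  have aI: "A \<le> a i" if "i \<in> I" for i
    using mono[of "s i" m] s_range[of i] that m by (simp add: a_def A_def I_def)
  have aJ: "a i \<le> b" if "i \<notin> I" for i
    using mono[of "m + 1" "s i"] s_range[of i] that by (simp add: a_def b_def I_def)
  have "s ` I = {1..m}"
  proof -
    have "s ` UNIV = {1..CARD('n)}" using s by (simp add: bij_betw_def)
    then show ?thesis using m by (fastforce simp: I_def image_iff set_eq_iff)
  qed
  moreover have "inj_on s I" using s by (auto simp: bij_betw_def intro: inj_on_subset)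
  ultimately have cardI: "card I = CARD('m)" using card_image[of s I] by (simp add: m_def)
  have E0: "E0 H X = diag_energy a (ctranspose U ** X)" for X :: "complex^'m^'n"
    unfolding a_def by (rule E0_diagonalize[OF U(2) HU])
  \<comment> \<open>Chosen so that \<open>4 * M * norm (X - X0)\<close> stays below
    \<open>(1 - \<alpha>) * (A - b)\<close>.\<close>
  define \<delta> where "\<delta> = (1 - \<alpha>) * (A - b) / (4 * M)"
  have "0 < \<delta>" using \<alpha> bA M by (simp add: \<delta>_def)
  moreover have "\<alpha> * (A - b) * (norm (X - X0))\<^sup>2 \<le> E0 H X - E0 H X0"
    if near: "X0 \<in> minimizers (\<lambda>G. norm (X - G)) (S H 0)" and dist: "norm (X - X0) < \<delta>" for X X0 :: "complex^'m^'n"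
  proof -
    let ?Y = "ctranspose U ** X" and ?Ynear = "ctranspose U ** X0"
    have X0: "X0 \<in> S H 0" and nearest: "\<And>G. G \<in> S H 0 \<Longrightarrow> norm (X - X0) \<le> norm (X - G)"
      using near by (auto simp: mem_minimizers_iff)
    have min: "diag_energy a ?Ynear \<le> diag_energy a Z" for Z :: "complex^'m^'n"
    proof -
      have "ctranspose U ** (U ** Z) = Z" by (simp add: matrix_mul_assoc U)
      then show ?thesis using X0 by (metis E0 E_0 mem_S_iff)
    qed
    note frame = diag_energy_minimizer_frame[OF a0 cardI less_trans[OF b0 bA] bA aI aJ min]
    have "ctranspose ?Ynear ** ?Y = ctranspose X0 ** (U ** ctranspose U) ** X"
      by (simp add: ctranspose_mult matrix_mul_assoc)
    then have gram: "ctranspose ?Ynear ** ?Y = ctranspose X0 ** X" by (simp add: U)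
    \<comment> \<open>The whole unitary orbit of \<open>X0\<close> lies in \<open>S H 0\<close>, so
      \<open>X0\<close> is its point nearest to \<open>X\<close>.\<close>
    have "ctranspose (ctranspose X0 ** X) = ctranspose X0 ** X"
      by (intro nearest_orbit_point_hermitian nearest S_0_mult_unitary[OF H(1) X0])
    then have herm: "ctranspose (ctranspose ?Ynear ** ?Y) = ctranspose ?Ynear ** ?Y" by (simp only: gram)
    have "norm (?Y - ?Ynear) = norm (X - X0)"
      using norm_unitary_mult[of "ctranspose U" "X - X0"] U by (simp add: matrix_diff_ldistrib)
    then have "(A - b - 4 * M * norm (X - X0)) * (norm (X - X0))\<^sup>2 \<le> diag_energy a ?Y + sum a I"
      using diag_energy_growth[OF less_imp_le[OF a0] aM less_imp_le[OF b0] less_imp_le[OF bA] aI aJ frame herm]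
      by simp
    also have "\<dots> = E0 H X - E0 H X0"
      by (simp add: E0 diag_energy_coord_proj[OF frame(2)])
    finally have growth: "(A - b - 4 * M * norm (X - X0)) * (norm (X - X0))\<^sup>2 \<le> E0 H X - E0 H X0" .
    have "4 * M * norm (X - X0) \<le> (1 - \<alpha>) * (A - b)"
      using dist M by (simp add: \<delta>_def pos_less_divide_eq mult.commute)
    then have "\<alpha> * (A - b) \<le> A - b - 4 * M * norm (X - X0)" by (simp add: algebra_simps)
    then have "\<alpha> * (A - b) * (norm (X - X0))\<^sup>2 \<le> (A - b - 4 * M * norm (X - X0)) * (norm (X - X0))\<^sup>2"
      by (rule mult_right_mono) simp
    then show ?thesis using growth by linarith
  qed
  moreover have "A - b = ev (CARD('m) + 1) - ev CARD('m)" by (simp add: A_def b_def m_def)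
  ultimately show ?thesis by (intro exI[of _ \<delta>]) auto
qed

theorem corollary1:
  fixes H :: "complex^'n^'n" and ev :: "nat \<Rightarrow> real" and \<alpha> :: real
  assumes "hermitian H" and "negative_definite H"
    and "ordered_eigenvalues H ev" and "ev CARD('n) < 0"
    and "0 < \<alpha>" and "\<alpha> < 1"
  shows "(\<forall>\<mu>\<ge>0. (S H \<mu> :: (complex^'m^'n) set) \<noteq> {}) \<and>
    minimizers l1_norm (S H 0 :: (complex^'m^'n) set) \<noteq> {} \<and>
    (\<forall>\<mu>>0. min_value (E H \<mu>) (UNIV :: (complex^'m^'n) set) -
             min_value (E0 H) (UNIV :: (complex^'m^'n) set)
             \<le> \<mu> * min_value l1_norm (S H 0 :: (complex^'m^'n) set)) \<and>
    (CARD('m) < CARD('n) \<and> ev CARD('m) < ev (CARD('m) + 1) \<longrightarrow>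
      (\<exists>\<mu>\<^sub>0>0. \<forall>\<mu>. 0 < \<mu> \<and> \<mu> < \<mu>\<^sub>0 \<longrightarrow>
        (\<forall>X\<in>(S H \<mu> :: (complex^'m^'n) set).
          let nearest = minimizers (\<lambda>G. norm (X - G)) (S H 0);
              k = min_value (\<lambda>X\<^sub>0. nnz (X\<^sub>0 - X)) nearest
          in nearest \<noteq> {} \<and>
             E0 H X - min_value (E0 H) (UNIV :: (complex^'m^'n) set)
               \<le> \<mu>\<^sup>2 / (\<alpha> * (ev (CARD('m) + 1) - ev CARD('m))) * real k \<and>
             \<mu>\<^sup>2 / (\<alpha> * (ev (CARD('m) + 1) - ev CARD('m))) * real k
               \<le> \<mu>\<^sup>2 * real CARD('n) * real CARD('m) / (\<alpha> * (ev (CARD('m) + 1) - ev CARD('m))))))"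
proof -
  note H = \<open>hermitian H\<close> \<open>ordered_eigenvalues H ev\<close> \<open>ev CARD('n) < 0\<close>
  let ?S = "S H 0 :: (complex^'m^'n) set"
  have ne: "(S H \<mu> :: (complex^'m^'n) set) \<noteq> {}" if "0 \<le> \<mu>" for \<mu>
    using S_nonempty[OF H that] .
  have comp: "compact ?S" by (rule compact_S[OF H order_refl])
  have S0: "?S \<noteq> {}" by (rule ne[OF order_refl])
  have l1: "minimizers l1_norm ?S \<noteq> {}"
    using compact_minimizers_nonempty[OF comp S0 continuous_on_l1_norm] .
  then obtain G where G: "G \<in> minimizers l1_norm ?S" by blast
  then have GS: "G \<in> ?S" by (simp add: mem_minimizers_iff)
  have minE0: "min_value (E0 H) (UNIV :: (complex^'m^'n) set) = E0 H X0" if "X0 \<in> ?S" for X0 :: "complex^'m^'n"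
    using that min_value_eq[of X0 "E0 H" UNIV] by (simp add: S_def)
  have minE: "min_value (E H \<mu>) (UNIV :: (complex^'m^'n) set) = E H \<mu> X" if "X \<in> S H \<mu>" for X :: "complex^'m^'n" and \<mu>
    using that min_value_eq[of X "E H \<mu>" UNIV] by (simp add: S_def)
  have first: "min_value (E H \<mu>) (UNIV :: (complex^'m^'n) set) - min_value (E0 H) (UNIV :: (complex^'m^'n) set)
      \<le> \<mu> * min_value l1_norm ?S" if "0 < \<mu>" for \<mu>
  proof -
    obtain X :: "complex^'m^'n" where X: "X \<in> S H \<mu>" using ne[OF less_imp_le[OF \<open>0 < \<mu>\<close>]] by blast
    \<comment> \<open>The minimizer of \<open>E0 H\<close> with least l1 norm is tested as a
      competitor for the penalized energy.\<close>
    then have "E H \<mu> X \<le> E H \<mu> G" by (simp add: mem_S_iff)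
    then show ?thesis by (simp add: minE[OF X] minE0[OF GS] min_value_eq[OF G] E_def)
  qed
  have second: "\<exists>\<mu>\<^sub>0>0. \<forall>\<mu>. 0 < \<mu> \<and> \<mu> < \<mu>\<^sub>0 \<longrightarrow>
        (\<forall>X\<in>(S H \<mu> :: (complex^'m^'n) set).
          let nearest = minimizers (\<lambda>G. norm (X - G)) (S H 0);
              k = min_value (\<lambda>X\<^sub>0. nnz (X\<^sub>0 - X)) nearest
          in nearest \<noteq> {} \<and>
             E0 H X - min_value (E0 H) (UNIV :: (complex^'m^'n) set)
               \<le> \<mu>\<^sup>2 / (\<alpha> * (ev (CARD('m) + 1) - ev CARD('m))) * real k \<and>
             \<mu>\<^sup>2 / (\<alpha> * (ev (CARD('m) + 1) - ev CARD('m))) * real k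
               \<le> \<mu>\<^sup>2 * real CARD('n) * real CARD('m) / (\<alpha> * (ev (CARD('m) + 1) - ev CARD('m))))"
    if gap: "CARD('m) < CARD('n)" "ev CARD('m) < ev (CARD('m) + 1)"
  proof -
    define c where "c = \<alpha> * (ev (CARD('m) + 1) - ev CARD('m))"
    have c: "0 < c" using gap \<open>0 < \<alpha>\<close> by (simp add: c_def)
    obtain \<delta> where \<delta>: "0 < \<delta>" and growth: "\<And>X X0 :: complex^'m^'n. \<lbrakk>X0 \<in> minimizers (\<lambda>G. norm (X - G)) (S H 0); norm (X - X0) < \<delta>\<rbrakk>
        \<Longrightarrow> c * (norm (X - X0))\<^sup>2 \<le> E0 H X - E0 H X0"
      using E0_quadratic_growth[OF H gap \<open>\<alpha> < 1\<close>] unfolding c_def by blast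
    obtain \<eta> where \<eta>: "0 < \<eta>" and close: "\<And>X :: complex^'m^'n. E0 H X - E0 H G < \<eta> \<Longrightarrow> \<exists>X0\<in>S H 0. norm (X - X0) < \<delta>"
      using small_E0_excess_near_S[OF H GS \<delta>] by blast
    \<comment> \<open>Comparison with \<open>G\<close> bounds the excess of \<open>X\<close> by
      \<open>\<mu> * (l1_norm G + 1)\<close>, which this threshold keeps below
      \<open>\<eta>\<close>; the \<open>+ 1\<close> keeps the divisor positive.\<close>
    define \<mu>\<^sub>0 where "\<mu>\<^sub>0 = \<eta> / (l1_norm G + 1)"
    have G1: "0 < l1_norm G + 1" using l1_norm_nonneg[of G] by linarith
    have "0 < \<mu>\<^sub>0" using \<eta> G1 by (simp add: \<mu>\<^sub>0_def)
    moreover have "minimizers (\<lambda>G. norm (X - G)) ?S \<noteq> {} \<and>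
             E0 H X - min_value (E0 H) (UNIV :: (complex^'m^'n) set)
               \<le> \<mu>\<^sup>2 / c * real (min_value (\<lambda>X\<^sub>0. nnz (X\<^sub>0 - X)) (minimizers (\<lambda>G. norm (X - G)) ?S)) \<and>
             \<mu>\<^sup>2 / c * real (min_value (\<lambda>X\<^sub>0. nnz (X\<^sub>0 - X)) (minimizers (\<lambda>G. norm (X - G)) ?S))
               \<le> \<mu>\<^sup>2 * real CARD('n) * real CARD('m) / c"
      if \<mu>: "0 < \<mu>" "\<mu> < \<mu>\<^sub>0" and X: "X \<in> S H \<mu>" for \<mu> and X :: "complex^'m^'n"
    proof -
      let ?near = "minimizers (\<lambda>G. norm (X - G)) ?S"
      have near: "?near \<noteq> {}"
        by (intro compact_minimizers_nonempty comp S0 continuous_intros)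
      \<comment> \<open>The count attains its minimum, so a single nearest minimizer
        \<open>X0\<close> serves both for the growth bound and for \<open>k\<close>.\<close>
      from minimizers_nat_nonempty[OF this, of "\<lambda>X\<^sub>0. nnz (X\<^sub>0 - X)"]
      obtain X0 where X0min: "X0 \<in> minimizers (\<lambda>X\<^sub>0. nnz (X\<^sub>0 - X)) ?near" by blast
      then have X0: "X0 \<in> ?near" by (simp add: mem_minimizers_iff)
      then have X0S: "X0 \<in> ?S" by (simp add: mem_minimizers_iff)
      define k where "k = nnz (X0 - X)"
      define r where "r = E0 H X - E0 H X0"
      define d where "d = norm (X - X0)"
      have k: "min_value (\<lambda>X\<^sub>0. nnz (X\<^sub>0 - X)) ?near = k"
        unfolding k_def by (rule min_value_eq[OF X0min])
      have cmp: "E0 H X + \<mu> * l1_norm X \<le> E0 H Z + \<mu> * l1_norm Z" for Z :: "complex^'m^'n"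
        using X by (simp add: mem_S_iff E_def)
      have "E0 H X - E0 H G \<le> \<mu> * (l1_norm G - l1_norm X)" using cmp[of G] by (simp add: algebra_simps)
      also have "\<dots> \<le> \<mu> * (l1_norm G + 1)"
        using \<mu> l1_norm_nonneg[of X] by (intro mult_left_mono) auto
      also have "\<dots> < \<eta>" using \<mu> G1 by (simp add: \<mu>\<^sub>0_def pos_less_divide_eq)
      finally obtain X1 where "X1 \<in> ?S" "norm (X - X1) < \<delta>" using close by blast
      \<comment> \<open>\<open>X0\<close> is at least as near to \<open>X\<close> as the minimizer
        \<open>X1\<close> supplied by compactness.\<close>
      then have "norm (X - X0) < \<delta>" using X0 by (force simp: mem_minimizers_iff)
      from growth[OF X0 this] have cd: "c * d\<^sup>2 \<le> r" by (simp add: d_def r_def)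
      \<comment> \<open>Optimality of \<open>X\<close> against \<open>X0\<close> bounds the excess
        above by a multiple of \<open>d\<close>, while growth bounds it below by a multiple of
        \<open>d\<^sup>2\<close>.\<close>
      have "r \<le> \<mu> * (l1_norm X0 - l1_norm X)" using cmp[of X0] by (simp add: r_def algebra_simps)
      also have "\<dots> \<le> \<mu> * (sqrt (real k) * d)"
        using l1_norm_triangle[of X0 X] l1_norm_le_nnz[of "X0 - X"] \<mu>
        by (intro mult_left_mono) (auto simp: k_def d_def norm_minus_commute)
      finally have r: "r \<le> \<mu> * (sqrt (real k) * d)" .
      have "0 \<le> c * d\<^sup>2" using c by simp
      then have r0: "0 \<le> r" using cd by linarith
      have "r \<le> \<mu>\<^sup>2 / c * real k"
      \<comment> \<open>Squaring the upper bound and inserting \<open>c * d\<^sup>2 \<le> r\<close>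
        eliminates \<open>d\<close>; cancelling one factor \<open>r\<close> requires it to be
        nonzero.\<close>
      proof (cases "r = 0")
        case False
        have "c * r\<^sup>2 \<le> c * (\<mu> * (sqrt (real k) * d))\<^sup>2"
          using r r0 c by (intro mult_left_mono power_mono) auto
        also have "\<dots> = \<mu>\<^sup>2 * real k * (c * d\<^sup>2)" by (simp add: power_mult_distrib)
        also have "\<dots> \<le> \<mu>\<^sup>2 * real k * r" using cd by (intro mult_left_mono) auto
        finally have "(c * r) * r \<le> (\<mu>\<^sup>2 * real k) * r" by (simp add: power2_eq_square mult.assoc)
        then have "c * r \<le> \<mu>\<^sup>2 * real k" using False r0 by (simp add: mult_le_cancel_right)
        then show ?thesis using c by (simp add: field_simps)
      qed (use c in simp)
      moreover have "\<mu>\<^sup>2 / c * real k \<le> \<mu>\<^sup>2 * real CARD('n) * real CARD('m) / c"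
      proof -
        have "real k \<le> real (CARD('n) * CARD('m))" using nnz_le[of "X0 - X"] unfolding k_def by (simp only: of_nat_le_iff)
        then have "\<mu>\<^sup>2 / c * real k \<le> \<mu>\<^sup>2 / c * real (CARD('n) * CARD('m))" using c by (intro mult_left_mono) auto
        then show ?thesis by simp
      qed
      ultimately show ?thesis using near by (simp only: k minE0[OF X0S] r_def simp_thms)
    qed
    ultimately show ?thesis unfolding Let_def c_def by blast
  qed
  show ?thesis using ne l1 first second by blast
qed

end
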